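(* Let $(M^{2m+1},g,\xi)$ be a compact Sasakian spin manifold carrying a non-zero $(\alpha,0)$-transversal Killing spinor $\psi$ with $\alpha\in\mathbb{R}$, $\alpha\neq0$, normalised so that $|\psi|=1$. Assume that $$\lambda_1(D_M^2)=\alpha^2+\frac{m^2}{4}+\alpha\frac{\int_M\langle\xi\cdot\Omega\cdot\psi,\psi\rangle v_g}{\mathrm{Vol}(M)},$$ where $\lambda_1(D_M^2)$ is the lowest eigenvalue of the square of the Dirac operator of $(M,g)$. Let $\psi_0$ and $\psi_m$ denote the components of $\psi$ in $\Sigma_0M$ and $\Sigma_mM$. \begin{itemize} \item If $\psi_0\neq0$ and $\alpha>0$, then the spinor field $\overline{\psi_0}^t$ corresponding to $\psi_0$ on the Sasakian manifold $(M^{2m+1},\overline{g}_t,\overline{\xi}^t)$ is harmonic for $t=\frac{2\alpha}{m}$. \item If $\psi_m\neq0$ and $(-1)^{m+1}\alpha>0$, then the spinor field $\overline{\psi_m}^t$ corresponding to $\psi_m$ on the Sasakian manifold $(M^{2m+1},\overline{g}_t,\overline{\xi}^t)$ is harmonic for $t=(-1)^{m+1}\frac{2\alpha}{m}$. \end{itemize}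
   Context: A Riemannian flow $(M^{n+1},g,\mathcal{F})$ is a Riemannian manifold with a $1$-dimensional foliation defined by a unit vector field $\xi$ such that $(\mathcal{L}_\xi g)(Z,W)=0$ for all $Z,W\perp\xi$. Put $Q:=\xi^\perp$, $\pi:TM\to Q$ the orthogonal projection, $\nabla^M$ the Levi-Civita connection. The transversal Levi-Civita connection on $Q$ is $\nabla_\xi Z=\pi[\xi,Z]$, $\nabla_XZ=\pi(\nabla^M_XZ)$ for $X\perp\xi$. The O'Neill tensor is $h(Z):=\nabla^M_Z\xi$ for $Z\in\Gamma(Q)$, the mean curvature is $\kappa:=\nabla^M_\xi\xi$, and $\Omega(Z,W):=g(h(Z),W)$ is a $2$-form on $Q$. A Sasakian manifold $(M^{2m+1},g,\xi)$ ($n=2m$) is a Riemannian flow with $\kappa=0$, $h^2=-\mathrm{Id}_Q$ and $\nabla h=0$. $\Sigma M$ is the complex spinor bundle with Hermitian product $\langle\cdot,\cdot\rangle$, Clifford multiplication "$\cdot$" ($X\cdot X\cdot=-|X|^2$), spinorial Levi-Civita derivative $\nabla^M$ and Dirac operator $D_M$; $\Omega$ acts as $\frac12\sum_{j=1}^{n}e_j\cdot h(e_j)\cdot$ for a local orthonormal frame $\{e_j\}$ of $Q$. The transversal derivative $\nabla$ on $\Sigma M$ is determined (here $\kappa=0$) by $\nabla^M_\xi\psi=\nabla_\xi\psi+\frac12\Omega\cdot\psi$ and $\nabla^M_Z\psi=\nabla_Z\psi+\frac12\xi\cdot h(Z)\cdot\psi$ for $Z\in\Gamma(Q)$. An $(\alpha,0)$-transversal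 Killing spinor is a smooth section $\psi$ of $\Sigma M$ with $\nabla_\xi\psi=\alpha\,\xi\cdot\psi$ and $\nabla_Z\psi=0$ for all $Z\in\Gamma(Q)$. On a Sasakian spin manifold, $\Sigma M=\oplus_{r=0}^m\Sigma_rM$ orthogonally, where $\Sigma_rM$ is the eigenbundle (of rank $\binom{m}{r}$) of the Clifford action of $\Omega$ for the eigenvalue $i(2r-m)$; the convention is that $\xi\cdot\psi_r=(-1)^{r+1}i\psi_r$ for $\psi_r\in\Gamma(\Sigma_rM)$. For real $t>0$, the $\mathcal{D}$-homothetic deformation of $g$ is the metric $\overline{g}_t:=t^2g|_\xi+t\,g|_Q$ (i.e. $g$ is multiplied by $t^2$ on $\mathbb{R}\xi$ and by $t$ on $Q$, the two remaining orthogonal); with $\overline{\xi}^t:=\frac1t\xi$, $(M,\overline{g}_t,\overline{\xi}^t)$ is again Sasakian. The bundle isometry $(TM,g)\to(TM,\overline{g}_t)$, $\xi\mapsto\overline{\xi}^t=\frac1t\xi$, $Z\mapsto\overline{Z}^t=\frac{1}{\sqrt t}Z$ ($Z\in Q$), lifts to a unitary isomorphism $\varphi\mapsto\overline{\varphi}^t$ between the spinor bundles of $(M,g)$ and $(M,\overline{g}_t)$ (for the same spin structure) compatible with Clifford multiplication: $\overline{X}^t\,\overline{\cdot}\,\overline{\varphi}^t=\overline{X\cdot\varphi}^t$. A spinor field is harmonic on $(M,\overline{g}_t)$ if it lies in the kernel of the Dirac operator of $(M,\overline{g}_t)$. *)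

theory Defs
  imports "HOL-Analysis.Analysis"
begin

section \<open>Smooth manifolds\<close>

primrec Ck_on :: "nat \<Rightarrow> ('b::real_normed_vector \<Rightarrow> 'c::real_normed_vector) \<Rightarrow> 'b set \<Rightarrow> bool" where
  "Ck_on 0 f S \<longleftrightarrow> continuous_on S f"
| "Ck_on (Suc k) f S \<longleftrightarrow>
     (\<forall>x\<in>S. f differentiable (at x)) \<and> (\<forall>v. Ck_on k (\<lambda>x. frechet_derivative f (at x) v) S)"

text \<open>Only used for open \<open>S\<close> in a finite-dimensional space.\<close>
definition smooth_on :: "('b::real_normed_vector \<Rightarrow> 'c::real_normed_vector) \<Rightarrow> 'b set \<Rightarrow> bool" where
  "smooth_on f S \<longleftrightarrow> (\<forall>k. Ck_on k f S)"

text \<open>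
  The whole type \<open>'a\<close> is the manifold.  The atlas is indexed by the points, \<open>chart M p\<close> being a chart
  around \<open>p\<close>; every smooth structure is given by such an atlas.  The tangent space at \<open>p\<close> is
  identified with \<open>real^'n\<close> through the chart \<open>chart M p\<close>, so a vector field is a function
  \<open>'a \<Rightarrow> real^'n\<close>, whose smoothness has to be tested after passing to a fixed chart.
\<close>
record ('a, 'n::finite) atlas =
  chart_dom :: "'a \<Rightarrow> 'a set"
  chart :: "'a \<Rightarrow> 'a \<Rightarrow> real^'n"

definition inv_chart :: "('a, 'n::finite) atlas \<Rightarrow> 'a \<Rightarrow> real^'n \<Rightarrow> 'a" where
  "inv_chart M p = inv_into (chart_dom M p) (chart M p)"

definition chart_change :: "('a, 'n::finite) atlas \<Rightarrow> 'a \<Rightarrow> 'a \<Rightarrow> real^'n \<Rightarrow> real^'n" where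
  "chart_change M p q = chart M q \<circ> inv_chart M p"

definition smooth_manifold ::
    "('a::{t2_space,second_countable_topology}, 'n::finite) atlas \<Rightarrow> bool" where
  "smooth_manifold M \<longleftrightarrow>
     (\<forall>p. p \<in> chart_dom M p \<and> open (chart_dom M p) \<and> open (chart M p ` chart_dom M p) \<and>
          homeomorphism (chart_dom M p) (chart M p ` chart_dom M p) (chart M p) (inv_chart M p)) \<and>
     (\<forall>p q. smooth_on (chart_change M p q) (chart M p ` (chart_dom M p \<inter> chart_dom M q)))"

definition smooth_map ::
    "('a, 'n::finite) atlas \<Rightarrow> 'a set \<Rightarrow> ('a \<Rightarrow> 'c::real_normed_vector) \<Rightarrow> bool" where
  "smooth_map M U f \<longleftrightarrow>
     (\<forall>p. smooth_on (f \<circ> inv_chart M p) (chart M p ` (chart_dom M p \<inter> U)))"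

definition dir_deriv ::
    "('a, 'n::finite) atlas \<Rightarrow> ('a \<Rightarrow> 'c::real_normed_vector) \<Rightarrow> 'a \<Rightarrow> real^'n \<Rightarrow> 'c" where
  "dir_deriv M f p v = frechet_derivative (f \<circ> inv_chart M p) (at (chart M p p)) v"

text \<open>Components of the vector field \<open>X\<close> in the coordinates of the fixed chart \<open>chart M p\<close>.\<close>
definition chart_rep ::
    "('a, 'n::finite) atlas \<Rightarrow> 'a \<Rightarrow> ('a \<Rightarrow> real^'n) \<Rightarrow> real^'n \<Rightarrow> real^'n" where
  "chart_rep M p X u =
     (let q = inv_chart M p u in frechet_derivative (chart_change M q p) (at (chart M q q)) (X q))"

definition smooth_vf :: "('a, 'n::finite) atlas \<Rightarrow> 'a set \<Rightarrow> ('a \<Rightarrow> real^'n) \<Rightarrow> bool" where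
  "smooth_vf M U X \<longleftrightarrow> (\<forall>p. smooth_on (chart_rep M p X) (chart M p ` (chart_dom M p \<inter> U)))"

definition lie_bracket ::
    "('a, 'n::finite) atlas \<Rightarrow> ('a \<Rightarrow> real^'n) \<Rightarrow> ('a \<Rightarrow> real^'n) \<Rightarrow> 'a \<Rightarrow> real^'n" where
  "lie_bracket M X Y p =
     frechet_derivative (chart_rep M p Y) (at (chart M p p)) (X p) -
     frechet_derivative (chart_rep M p X) (at (chart M p p)) (Y p)"

section \<open>Riemannian metrics\<close>

type_synonym ('a, 'n) metric = "'a \<Rightarrow> real^'n \<Rightarrow> real^'n \<Rightarrow> real"

definition riemannian_metric ::
    "('a::topological_space, 'n::finite) atlas \<Rightarrow> ('a, 'n) metric \<Rightarrow> bool" where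
  "riemannian_metric M g \<longleftrightarrow>
     (\<forall>p. bilinear (g p) \<and> (\<forall>v w. g p v w = g p w v) \<and> (\<forall>v. v \<noteq> 0 \<longrightarrow> g p v v > 0)) \<and>
     (\<forall>U X Y. open U \<and> smooth_vf M U X \<and> smooth_vf M U Y \<longrightarrow> smooth_map M U (\<lambda>q. g q (X q) (Y q)))"

text \<open>\<open>D p v Y\<close> is the covariant derivative at \<open>p\<close>, in the direction \<open>v\<close>, of a vector field \<open>Y\<close>
  that is defined and smooth near \<open>p\<close>; for other \<open>Y\<close> it is unspecified.\<close>
type_synonym ('a, 'n) connection = "'a \<Rightarrow> real^'n \<Rightarrow> ('a \<Rightarrow> real^'n) \<Rightarrow> real^'n"

definition affine_connection ::
    "('a::topological_space, 'n::finite) atlas \<Rightarrow> ('a, 'n) connection \<Rightarrow> bool" where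
  "affine_connection M D \<longleftrightarrow>
     (\<forall>U Y. open U \<and> smooth_vf M U Y \<longrightarrow>
        (\<forall>p\<in>U. linear (\<lambda>v. D p v Y)) \<and>
        (\<forall>X. smooth_vf M U X \<longrightarrow> smooth_vf M U (\<lambda>q. D q (X q) Y)) \<and>
        (\<forall>Z. smooth_vf M U Z \<longrightarrow> (\<forall>p\<in>U. \<forall>v. D p v (\<lambda>q. Y q + Z q) = D p v Y + D p v Z)) \<and>
        (\<forall>f. smooth_map M U f \<longrightarrow>
          (\<forall>p\<in>U. \<forall>v. D p v (\<lambda>q. f q *\<^sub>R Y q) = dir_deriv M f p v *\<^sub>R Y p + f p *\<^sub>R D p v Y)))"

definition levi_civita ::
    "('a::topological_space, 'n::finite) atlas \<Rightarrow> ('a, 'n) metric \<Rightarrow> ('a, 'n) connection \<Rightarrow> bool" where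
  "levi_civita M g D \<longleftrightarrow> affine_connection M D \<and>
     (\<forall>U Y Z. open U \<and> smooth_vf M U Y \<and> smooth_vf M U Z \<longrightarrow>
        (\<forall>p\<in>U. D p (Y p) Z - D p (Z p) Y = lie_bracket M Y Z p) \<and>
        (\<forall>p\<in>U. \<forall>v. dir_deriv M (\<lambda>q. g q (Y q) (Z q)) p v = g p (D p v Y) (Z p) + g p (Y p) (D p v Z)))"

definition riemannian_volume ::
    "('a::topological_space, 'n::finite) atlas \<Rightarrow> ('a, 'n) metric \<Rightarrow> 'a measure" where
  "riemannian_volume M g = (THE \<mu>. sets \<mu> = sets borel \<and>
     (\<forall>p. \<forall>B\<in>sets borel. B \<subseteq> chart_dom M p \<longrightarrow>
        emeasure \<mu> B = (\<integral>\<^sup>+ u \<in> chart M p ` B. ennreal (sqrt (det (\<chi> a b.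
          (let q = inv_chart M p u; T = frechet_derivative (chart_change M p q) (at u)
           in g q (T (axis a 1)) (T (axis b 1)))))) \<partial>lborel)))"

section \<open>Riemannian flows and Sasakian manifolds\<close>

text \<open>Orthogonal projection onto \<open>Q\<close>, the orthogonal complement of the unit vector field \<open>\<xi>\<close>.\<close>
definition proj_Q :: "('a, 'n::finite) metric \<Rightarrow> ('a \<Rightarrow> real^'n) \<Rightarrow> 'a \<Rightarrow> real^'n \<Rightarrow> real^'n" where
  "proj_Q g \<xi> p v = v - g p v (\<xi> p) *\<^sub>R \<xi> p"

definition section_Q ::
    "('a, 'n::finite) atlas \<Rightarrow> ('a, 'n) metric \<Rightarrow> ('a \<Rightarrow> real^'n) \<Rightarrow> 'a set \<Rightarrow> ('a \<Rightarrow> real^'n) \<Rightarrow> bool" where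
  "section_Q M g \<xi> U Z \<longleftrightarrow> smooth_vf M U Z \<and> (\<forall>p\<in>U. g p (Z p) (\<xi> p) = 0)"

definition lie_deriv_metric ::
    "('a, 'n::finite) atlas \<Rightarrow> ('a, 'n) metric \<Rightarrow> ('a \<Rightarrow> real^'n) \<Rightarrow>
     ('a \<Rightarrow> real^'n) \<Rightarrow> ('a \<Rightarrow> real^'n) \<Rightarrow> 'a \<Rightarrow> real" where
  "lie_deriv_metric M g X Z W p =
     dir_deriv M (\<lambda>q. g q (Z q) (W q)) p (X p)
       - g p (lie_bracket M X Z p) (W p) - g p (Z p) (lie_bracket M X W p)"

definition riemannian_flow ::
    "('a::topological_space, 'n::finite) atlas \<Rightarrow> ('a, 'n) metric \<Rightarrow> ('a \<Rightarrow> real^'n) \<Rightarrow> bool" where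
  "riemannian_flow M g \<xi> \<longleftrightarrow>
     smooth_vf M UNIV \<xi> \<and> (\<forall>p. g p (\<xi> p) (\<xi> p) = 1) \<and>
     (\<forall>U Z W. open U \<and> section_Q M g \<xi> U Z \<and> section_Q M g \<xi> U W \<longrightarrow>
        (\<forall>p\<in>U. lie_deriv_metric M g \<xi> Z W p = 0))"

text \<open>Only applied to \<open>Z\<close> in \<open>Q\<close>.\<close>
definition oneill :: "('a, 'n::finite) connection \<Rightarrow> ('a \<Rightarrow> real^'n) \<Rightarrow> 'a \<Rightarrow> real^'n \<Rightarrow> real^'n" where
  "oneill D \<xi> p Z = D p Z \<xi>"

text \<open>The two defining cases of the transversal Levi-Civita connection, \<open>v = \<xi>\<close> and \<open>v\<close> orthogonal
  to \<open>\<xi>\<close>, extended linearly to all \<open>v\<close>.\<close>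
definition transversal_conn ::
    "('a, 'n::finite) atlas \<Rightarrow> ('a, 'n) metric \<Rightarrow> ('a, 'n) connection \<Rightarrow> ('a \<Rightarrow> real^'n) \<Rightarrow>
     'a \<Rightarrow> real^'n \<Rightarrow> ('a \<Rightarrow> real^'n) \<Rightarrow> real^'n" where
  "transversal_conn M g D \<xi> p v Z =
     g p v (\<xi> p) *\<^sub>R proj_Q g \<xi> p (lie_bracket M \<xi> Z p)
       + proj_Q g \<xi> p (D p (proj_Q g \<xi> p v) Z)"

text \<open>The three conditions are: the mean curvature vanishes, \<open>h\<^sup>2 = -Id\<close> on \<open>Q\<close>, and \<open>\<nabla>h = 0\<close> for the
  transversal Levi-Civita connection.  Here \<open>D\<close> is the Levi-Civita connection of \<open>g\<close>.\<close>
definition sasakian ::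
    "('a::{t2_space,second_countable_topology}, 'n::finite) atlas \<Rightarrow> ('a, 'n) metric \<Rightarrow>
     ('a, 'n) connection \<Rightarrow> ('a \<Rightarrow> real^'n) \<Rightarrow> bool" where
  "sasakian M g D \<xi> \<longleftrightarrow>
     smooth_manifold M \<and> riemannian_metric M g \<and> levi_civita M g D \<and> riemannian_flow M g \<xi> \<and>
     (\<forall>p. D p (\<xi> p) \<xi> = 0) \<and>
     (\<forall>p Z. g p Z (\<xi> p) = 0 \<longrightarrow> oneill D \<xi> p (oneill D \<xi> p Z) = - Z) \<and>
     (\<forall>U Z. open U \<and> section_Q M g \<xi> U Z \<longrightarrow>
        (\<forall>p\<in>U. \<forall>v. transversal_conn M g D \<xi> p v (\<lambda>q. oneill D \<xi> q (Z q))
                 = oneill D \<xi> p (transversal_conn M g D \<xi> p v Z)))"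

section \<open>Spin structures and spinor fields\<close>

definition hinner :: "complex^'s::finite \<Rightarrow> complex^'s \<Rightarrow> complex" where
  "hinner \<phi> \<psi> = (\<Sum>a\<in>UNIV. \<phi> $ a * cnj (\<psi> $ a))"

text \<open>A representation of the Clifford algebra of \<open>real^'n\<close> with \<open>v \<cdot> v = -|v|\<^sup>2\<close>, given by the images of
  the standard basis vectors; unit vectors act unitarily.\<close>
definition clifford_rep :: "('n::finite \<Rightarrow> complex^'s::finite^'s) \<Rightarrow> bool" where
  "clifford_rep \<gamma> \<longleftrightarrow>
     (\<forall>k l. \<gamma> k ** \<gamma> l + \<gamma> l ** \<gamma> k = (if k = l then - mat 2 else 0)) \<and>
     (\<forall>k \<phi> \<psi>. hinner (\<gamma> k *v \<phi>) \<psi> = - hinner \<phi> (\<gamma> k *v \<psi>))"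

definition cliff :: "('n::finite \<Rightarrow> complex^'s::finite^'s) \<Rightarrow> real^'n \<Rightarrow> complex^'s^'s" where
  "cliff \<gamma> x = (\<Sum>k\<in>UNIV. x $ k *\<^sub>R \<gamma> k)"

text \<open>The image of the spin group, i.e. the products of evenly many unit vectors.  In odd dimension
  the complex spin representation is faithful, so this is a copy of the spin group itself.\<close>
inductive_set spin_group :: "('n::finite \<Rightarrow> complex^'s::finite^'s) \<Rightarrow> (complex^'s^'s) set"
  for \<gamma> :: "'n \<Rightarrow> complex^'s^'s" where
  "mat 1 \<in> spin_group \<gamma>"
| "A \<in> spin_group \<gamma> \<Longrightarrow> norm v = 1 \<Longrightarrow> norm w = 1 \<Longrightarrow> A ** cliff \<gamma> v ** cliff \<gamma> w \<in> spin_group \<gamma>"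

text \<open>
  A spin structure in terms of an open cover \<open>nbhd\<close>, an orthonormal frame \<open>frame i k\<close> over each member
  of the cover, and a cocycle \<open>lift i j\<close> with values in the spin group that covers the cocycle of
  frame changes.
\<close>
record ('a, 'n::finite, 's::finite, 'i) spin_data =
  gam :: "'n \<Rightarrow> complex^'s^'s"
  nbhd :: "'i \<Rightarrow> 'a set"
  frame :: "'i \<Rightarrow> 'n \<Rightarrow> 'a \<Rightarrow> real^'n"
  lift :: "'i \<Rightarrow> 'i \<Rightarrow> 'a \<Rightarrow> complex^'s^'s"

definition frame_coords ::
    "('a, 'n::finite) metric \<Rightarrow> ('a, 'n, 's::finite, 'i) spin_data \<Rightarrow> 'i \<Rightarrow> 'a \<Rightarrow> real^'n \<Rightarrow> real^'n" where
  "frame_coords g \<sigma> i p v = (\<chi> k. g p v (frame \<sigma> i k p))"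

text \<open>Clifford multiplication by the tangent vector \<open>v\<close> in the trivialisation \<open>i\<close>.\<close>
definition clifford_mult ::
    "('a, 'n::finite) metric \<Rightarrow> ('a, 'n, 's::finite, 'i) spin_data \<Rightarrow> 'i \<Rightarrow> 'a \<Rightarrow> real^'n \<Rightarrow>
     complex^'s^'s" where
  "clifford_mult g \<sigma> i p v = cliff (gam \<sigma>) (frame_coords g \<sigma> i p v)"

text \<open>The condition on \<open>lift i j\<close> and \<open>frame j\<close> says that the image of the spin transformation
  \<open>lift i j p\<close> in the rotation group is the matrix expressing the frame \<open>j\<close> through the frame \<open>i\<close>.\<close>
definition spin_structure ::
    "('a::topological_space, 'n::finite) atlas \<Rightarrow> ('a, 'n) metric \<Rightarrow>
     ('a, 'n, 's::finite, 'i) spin_data \<Rightarrow> bool" where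
  "spin_structure M g \<sigma> \<longleftrightarrow>
     clifford_rep (gam \<sigma>) \<and>
     (\<forall>i. open (nbhd \<sigma> i)) \<and> (\<Union>i. nbhd \<sigma> i) = UNIV \<and>
     (\<forall>i k. smooth_vf M (nbhd \<sigma> i) (frame \<sigma> i k)) \<and>
     (\<forall>i. \<forall>p\<in>nbhd \<sigma> i. \<forall>k l. g p (frame \<sigma> i k p) (frame \<sigma> i l p) = (if k = l then 1 else 0)) \<and>
     (\<forall>i j. smooth_map M (nbhd \<sigma> i \<inter> nbhd \<sigma> j) (lift \<sigma> i j)) \<and>
     (\<forall>i j. \<forall>p\<in>nbhd \<sigma> i \<inter> nbhd \<sigma> j. lift \<sigma> i j p \<in> spin_group (gam \<sigma>) \<and>
        (\<forall>l. lift \<sigma> i j p ** gam \<sigma> l = clifford_mult g \<sigma> i p (frame \<sigma> j l p) ** lift \<sigma> i j p)) \<and>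
     (\<forall>i j k. \<forall>p\<in>nbhd \<sigma> i \<inter> nbhd \<sigma> j \<inter> nbhd \<sigma> k. lift \<sigma> i j p ** lift \<sigma> j k p = lift \<sigma> i k p)"

text \<open>A spinor field is the family of its component functions \<open>\<phi> i\<close> with respect to the lifted frames;
  values of \<open>\<phi> i\<close> outside \<open>nbhd \<sigma> i\<close> are irrelevant.\<close>
type_synonym ('a, 's, 'i) spinor = "'i \<Rightarrow> 'a \<Rightarrow> complex^'s"

definition spinor_field ::
    "('a, 'n::finite) atlas \<Rightarrow> ('a, 'n, 's::finite, 'i) spin_data \<Rightarrow> ('a, 's, 'i) spinor \<Rightarrow> bool" where
  "spinor_field M \<sigma> \<phi> \<longleftrightarrow>
     (\<forall>i. smooth_map M (nbhd \<sigma> i) (\<phi> i)) \<and>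
     (\<forall>i j. \<forall>p\<in>nbhd \<sigma> i \<inter> nbhd \<sigma> j. \<phi> i p = lift \<sigma> i j p *v \<phi> j p)"

definition nonzero_spinor ::
    "('a, 'n::finite, 's::finite, 'i) spin_data \<Rightarrow> ('a, 's, 'i) spinor \<Rightarrow> bool" where
  "nonzero_spinor \<sigma> \<phi> \<longleftrightarrow> (\<exists>i. \<exists>p\<in>nbhd \<sigma> i. \<phi> i p \<noteq> 0)"

text \<open>The Hermitian product of two spinor fields, evaluated in any trivialisation around the point.\<close>
definition spinor_hprod ::
    "('a, 'n::finite, 's::finite, 'i) spin_data \<Rightarrow> ('a, 's, 'i) spinor \<Rightarrow> ('a, 's, 'i) spinor \<Rightarrow>
     'a \<Rightarrow> complex" where
  "spinor_hprod \<sigma> \<phi> \<psi> p = (let i = (SOME i. p \<in> nbhd \<sigma> i) in hinner (\<phi> i p) (\<psi> i p))"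

text \<open>The spinorial Levi-Civita derivative.  With the convention \<open>v \<cdot> v = -|v|\<^sup>2\<close> its connection form in an
  orthonormal frame is \<open>1/2 \<Sum>\<^bsub>k<l\<^esub> g(\<nabla>e\<^sub>k, e\<^sub>l) e\<^sub>k \<cdot> e\<^sub>l\<close>; the sum below runs over all ordered pairs.\<close>
definition spin_deriv ::
    "('a, 'n::finite) atlas \<Rightarrow> ('a, 'n) metric \<Rightarrow> ('a, 'n) connection \<Rightarrow>
     ('a, 'n, 's::finite, 'i) spin_data \<Rightarrow> 'i \<Rightarrow> 'a \<Rightarrow> real^'n \<Rightarrow> ('a, 's, 'i) spinor \<Rightarrow> complex^'s" where
  "spin_deriv M g D \<sigma> i p v \<phi> =
     dir_deriv M (\<phi> i) p v +
     (1/4) *\<^sub>R (\<Sum>k\<in>UNIV. \<Sum>l\<in>UNIV.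
        g p (D p v (frame \<sigma> i k)) (frame \<sigma> i l p) *\<^sub>R (gam \<sigma> k *v (gam \<sigma> l *v \<phi> i p)))"

definition dirac ::
    "('a, 'n::finite) atlas \<Rightarrow> ('a, 'n) metric \<Rightarrow> ('a, 'n) connection \<Rightarrow>
     ('a, 'n, 's::finite, 'i) spin_data \<Rightarrow> ('a, 's, 'i) spinor \<Rightarrow> ('a, 's, 'i) spinor" where
  "dirac M g D \<sigma> \<phi> i p = (\<Sum>k\<in>UNIV. gam \<sigma> k *v spin_deriv M g D \<sigma> i p (frame \<sigma> i k p) \<phi>)"

definition dirac_sq_eigenvalue ::
    "('a, 'n::finite) atlas \<Rightarrow> ('a, 'n) metric \<Rightarrow> ('a, 'n) connection \<Rightarrow>
     ('a, 'n, 's::finite, 'i) spin_data \<Rightarrow> real \<Rightarrow> bool" where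
  "dirac_sq_eigenvalue M g D \<sigma> c \<longleftrightarrow>
     (\<exists>\<phi>. spinor_field M \<sigma> \<phi> \<and> nonzero_spinor \<sigma> \<phi> \<and>
        (\<forall>i. \<forall>p\<in>nbhd \<sigma> i. dirac M g D \<sigma> (dirac M g D \<sigma> \<phi>) i p = c *\<^sub>R \<phi> i p))"

definition lambda1_dirac_sq ::
    "('a, 'n::finite) atlas \<Rightarrow> ('a, 'n) metric \<Rightarrow> ('a, 'n) connection \<Rightarrow>
     ('a, 'n, 's::finite, 'i) spin_data \<Rightarrow> real" where
  "lambda1_dirac_sq M g D \<sigma> = (LEAST c. dirac_sq_eigenvalue M g D \<sigma> c)"

definition harmonic_spinor ::
    "('a, 'n::finite) atlas \<Rightarrow> ('a, 'n) metric \<Rightarrow> ('a, 'n) connection \<Rightarrow>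
     ('a, 'n, 's::finite, 'i) spin_data \<Rightarrow> ('a, 's, 'i) spinor \<Rightarrow> bool" where
  "harmonic_spinor M g D \<sigma> \<phi> \<longleftrightarrow>
     spinor_field M \<sigma> \<phi> \<and> (\<forall>i. \<forall>p\<in>nbhd \<sigma> i. dirac M g D \<sigma> \<phi> i p = 0)"

section \<open>Spinors on Riemannian flows\<close>

text \<open>
  The Clifford action of \<open>\<Omega>\<close> in the trivialisation \<open>i\<close>.  The spin frames \<open>e\<^sub>k\<close> need not be adapted to the
  flow, so the sum is written as \<open>1/2 \<Sum>\<^sub>k e\<^sub>k \<cdot> h(\<pi> e\<^sub>k)\<close>, over a frame of the whole tangent space; the
  lemma below shows that this is \<open>1/2 \<Sum>\<^sub>j b\<^sub>j \<cdot> h(b\<^sub>j)\<close> for every orthonormal frame \<open>b\<close> of \<open>Q\<close>.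
\<close>
definition Omega_cliff ::
    "('a, 'n::finite) metric \<Rightarrow> ('a, 'n) connection \<Rightarrow> ('a \<Rightarrow> real^'n) \<Rightarrow>
     ('a, 'n, 's::finite, 'i) spin_data \<Rightarrow> 'i \<Rightarrow> 'a \<Rightarrow> complex^'s^'s" where
  "Omega_cliff g D \<xi> \<sigma> i p =
     (1/2) *\<^sub>R (\<Sum>k\<in>UNIV. gam \<sigma> k **
        clifford_mult g \<sigma> i p (oneill D \<xi> p (proj_Q g \<xi> p (frame \<sigma> i k p))))"

lemma Omega_cliff_orthonormal_frame:
  fixes b :: "'j \<Rightarrow> real^'n::finite" and \<sigma> :: "('a::topological_space, 'n, 's::finite, 'i) spin_data"
  assumes g: "riemannian_metric M g" and lc: "levi_civita M g D" and flow: "riemannian_flow M g \<xi>"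
    and J: "finite J" "\<And>j. j \<in> J \<Longrightarrow> g p (b j) (\<xi> p) = 0"
      "\<And>j l. j \<in> J \<Longrightarrow> l \<in> J \<Longrightarrow> g p (b j) (b l) = (if j = l then 1 else 0)"
      "\<And>Z. g p Z (\<xi> p) = 0 \<Longrightarrow> Z \<in> span (b ` J)"
  shows "Omega_cliff g D \<xi> \<sigma> i p =
    (1/2) *\<^sub>R (\<Sum>j\<in>J. clifford_mult g \<sigma> i p (b j) ** clifford_mult g \<sigma> i p (oneill D \<xi> p (b j)))"
proof -
  have bil: "bilinear (g p)" and sym: "\<And>v w. g p v w = g p w v"
    using g unfolding riemannian_metric_def by auto
  have lin1: "linear (\<lambda>v. g p v w)" for w using bil unfolding bilinear_def by auto
  have unit: "g p (\<xi> p) (\<xi> p) = 1" and sm: "smooth_vf M UNIV \<xi>"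
    using flow unfolding riemannian_flow_def by auto
  have linD: "linear (\<lambda>v. D p v \<xi>)"
    using lc sm unfolding levi_civita_def affine_connection_def by (metis UNIV_I open_UNIV)
  have linC: "linear (clifford_mult g \<sigma> i p)"
    by (rule linearI)
      (simp_all add: clifford_mult_def cliff_def frame_coords_def linear_add[OF lin1]
        linear_scale[OF lin1] scaleR_add_left sum.distrib scaleR_sum_right)
  define L where "L v = clifford_mult g \<sigma> i p (oneill D \<xi> p v)" for v
  have linL: "linear L"
    by (rule linearI)
      (simp_all add: L_def oneill_def linear_add[OF linD] linear_scale[OF linD]
        linear_add[OF linC] linear_scale[OF linC])
  have linA: "linear (\<lambda>X. A ** X)" for A :: "complex^'s^'s"
    by (rule linearI)
      (simp_all add: vec_eq_iff matrix_matrix_mult_def sum.distrib scaleR_sum_right distrib_left)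
  have linB: "linear (\<lambda>X. X ** A)" for A :: "complex^'s^'s"
    by (rule linearI)
      (simp_all add: vec_eq_iff matrix_matrix_mult_def sum.distrib scaleR_sum_right distrib_right)
  have expand: "Z = (\<Sum>j\<in>J. g p Z (b j) *\<^sub>R b j)" if Z: "g p Z (\<xi> p) = 0" for Z
  proof -
    have lin: "linear (\<lambda>x. \<Sum>j\<in>J. g p x (b j) *\<^sub>R b j)"
      by (rule linearI)
        (simp_all add: linear_add[OF lin1] linear_scale[OF lin1] scaleR_add_left sum.distrib
          scaleR_sum_right)
    show ?thesis
    proof (rule linear_eq_on[OF linear_ident lin J(4)[OF Z]])
      fix x assume "x \<in> b ` J"
      then obtain l where l: "l \<in> J" "x = b l" by auto
      have "(\<Sum>j\<in>J. g p x (b j) *\<^sub>R b j) = (\<Sum>j\<in>J. if l = j then b j else 0)"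
        using l J(3) by (intro sum.cong) auto
      then show "x = (\<Sum>j\<in>J. g p x (b j) *\<^sub>R b j)" using l J(1) by simp
    qed
  qed
  have proj: "L (proj_Q g \<xi> p v) = (\<Sum>j\<in>J. g p v (b j) *\<^sub>R L (b j))" for v
  proof -
    have "g p (proj_Q g \<xi> p v) (\<xi> p) = 0"
      by (simp add: proj_Q_def linear_diff[OF lin1] linear_scale[OF lin1] unit)
    from expand[OF this]
    have "L (proj_Q g \<xi> p v) = L (\<Sum>j\<in>J. g p (proj_Q g \<xi> p v) (b j) *\<^sub>R b j)" by simp
    also have "\<dots> = (\<Sum>j\<in>J. g p (proj_Q g \<xi> p v) (b j) *\<^sub>R L (b j))"
      by (simp add: linear_sum[OF linL] linear_scale[OF linL])
    also have "\<dots> = (\<Sum>j\<in>J. g p v (b j) *\<^sub>R L (b j))"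
      using J(2) by (intro sum.cong)
        (auto simp: proj_Q_def linear_diff[OF lin1] linear_scale[OF lin1] sym[of "\<xi> p"])
    finally show ?thesis .
  qed
  have "(\<Sum>k\<in>UNIV. gam \<sigma> k ** L (proj_Q g \<xi> p (frame \<sigma> i k p)))
      = (\<Sum>k\<in>UNIV. \<Sum>j\<in>J. g p (b j) (frame \<sigma> i k p) *\<^sub>R (gam \<sigma> k ** L (b j)))"
    by (simp add: proj linear_sum[OF linA] linear_scale[OF linA] sym[of "frame \<sigma> i _ p"])
  also have "\<dots> = (\<Sum>j\<in>J. \<Sum>k\<in>UNIV. g p (b j) (frame \<sigma> i k p) *\<^sub>R (gam \<sigma> k ** L (b j)))"
    by (rule sum.swap)
  also have "\<dots> = (\<Sum>j\<in>J. clifford_mult g \<sigma> i p (b j) ** L (b j))"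
    by (simp add: clifford_mult_def cliff_def frame_coords_def linear_sum[OF linB] linear_scale[OF linB])
  finally show ?thesis by (simp add: Omega_cliff_def L_def)
qed

text \<open>The transversal derivative; both defining relations (for \<open>\<xi>\<close> and for vectors in \<open>Q\<close>) are combined
  by linearity in \<open>v\<close>.\<close>
definition transversal_spin_deriv ::
    "('a, 'n::finite) atlas \<Rightarrow> ('a, 'n) metric \<Rightarrow> ('a, 'n) connection \<Rightarrow> ('a \<Rightarrow> real^'n) \<Rightarrow>
     ('a, 'n, 's::finite, 'i) spin_data \<Rightarrow> 'i \<Rightarrow> 'a \<Rightarrow> real^'n \<Rightarrow> ('a, 's, 'i) spinor \<Rightarrow> complex^'s" where
  "transversal_spin_deriv M g D \<xi> \<sigma> i p v \<phi> =
     spin_deriv M g D \<sigma> i p v \<phi>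
       - (1/2 * g p v (\<xi> p)) *\<^sub>R (Omega_cliff g D \<xi> \<sigma> i p *v \<phi> i p)
       - (1/2) *\<^sub>R (clifford_mult g \<sigma> i p (\<xi> p) *v
           (clifford_mult g \<sigma> i p (oneill D \<xi> p (proj_Q g \<xi> p v)) *v \<phi> i p))"

text \<open>\<open>(\<alpha>,0)\<close>-transversal Killing spinors\<close>
definition transversal_killing_spinor ::
    "('a, 'n::finite) atlas \<Rightarrow> ('a, 'n) metric \<Rightarrow> ('a, 'n) connection \<Rightarrow> ('a \<Rightarrow> real^'n) \<Rightarrow>
     ('a, 'n, 's::finite, 'i) spin_data \<Rightarrow> real \<Rightarrow> ('a, 's, 'i) spinor \<Rightarrow> bool" where
  "transversal_killing_spinor M g D \<xi> \<sigma> \<alpha> \<psi> \<longleftrightarrow>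
     spinor_field M \<sigma> \<psi> \<and>
     (\<forall>i. \<forall>p\<in>nbhd \<sigma> i.
        transversal_spin_deriv M g D \<xi> \<sigma> i p (\<xi> p) \<psi> = \<alpha> *\<^sub>R (clifford_mult g \<sigma> i p (\<xi> p) *v \<psi> i p) \<and>
        (\<forall>Z. g p Z (\<xi> p) = 0 \<longrightarrow> transversal_spin_deriv M g D \<xi> \<sigma> i p Z \<psi> = 0))"

definition Sigma_fibre ::
    "('a, 'n::finite) metric \<Rightarrow> ('a, 'n) connection \<Rightarrow> ('a \<Rightarrow> real^'n) \<Rightarrow>
     ('a, 'n, 's::finite, 'i) spin_data \<Rightarrow> nat \<Rightarrow> nat \<Rightarrow> 'i \<Rightarrow> 'a \<Rightarrow> (complex^'s) set" where
  "Sigma_fibre g D \<xi> \<sigma> m r i p =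
     {w. Omega_cliff g D \<xi> \<sigma> i p *v w = (\<i> * (2 * of_nat r - of_nat m)) *s w}"

text \<open>This convention selects one of the two inequivalent representations of the Clifford algebra
  (equivalently, an orientation).\<close>
definition sigma_convention ::
    "('a, 'n::finite) metric \<Rightarrow> ('a, 'n) connection \<Rightarrow> ('a \<Rightarrow> real^'n) \<Rightarrow>
     ('a, 'n, 's::finite, 'i) spin_data \<Rightarrow> nat \<Rightarrow> bool" where
  "sigma_convention g D \<xi> \<sigma> m \<longleftrightarrow>
     (\<forall>r\<le>m. \<forall>i. \<forall>p\<in>nbhd \<sigma> i. \<forall>w\<in>Sigma_fibre g D \<xi> \<sigma> m r i p.
        clifford_mult g \<sigma> i p (\<xi> p) *v w = ((-1) ^ (r + 1) * \<i>) *s w)"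

text \<open>\<open>\<psi>c r\<close> is the component of \<open>\<psi>\<close> in the \<open>r\<close>-th eigenbundle, for \<open>r = 0, \<dots>, m\<close>.\<close>
definition Sigma_components ::
    "('a, 'n::finite) metric \<Rightarrow> ('a, 'n) connection \<Rightarrow> ('a \<Rightarrow> real^'n) \<Rightarrow>
     ('a, 'n, 's::finite, 'i) spin_data \<Rightarrow> nat \<Rightarrow> ('a, 's, 'i) spinor \<Rightarrow>
     (nat \<Rightarrow> ('a, 's, 'i) spinor) \<Rightarrow> bool" where
  "Sigma_components g D \<xi> \<sigma> m \<psi> \<psi>c \<longleftrightarrow>
     (\<forall>i. \<forall>p\<in>nbhd \<sigma> i.
        (\<forall>r\<le>m. \<psi>c r i p \<in> Sigma_fibre g D \<xi> \<sigma> m r i p) \<and> \<psi> i p = (\<Sum>r\<le>m. \<psi>c r i p))"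

section \<open>D-homothetic deformations\<close>

definition dhom_metric ::
    "('a, 'n::finite) metric \<Rightarrow> ('a \<Rightarrow> real^'n) \<Rightarrow> real \<Rightarrow> ('a, 'n) metric" where
  "dhom_metric g \<xi> t p v w =
     t\<^sup>2 * (g p v (\<xi> p) * g p w (\<xi> p)) + t * g p (proj_Q g \<xi> p v) (proj_Q g \<xi> p w)"

text \<open>The bundle isometry from \<open>g\<close> to the deformed metric.\<close>
definition dhom_isometry ::
    "('a, 'n::finite) metric \<Rightarrow> ('a \<Rightarrow> real^'n) \<Rightarrow> real \<Rightarrow> 'a \<Rightarrow> real^'n \<Rightarrow> real^'n" where
  "dhom_isometry g \<xi> t p v = (g p v (\<xi> p) / t) *\<^sub>R \<xi> p + (1 / sqrt t) *\<^sub>R proj_Q g \<xi> p v"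

text \<open>The isometry takes orthonormal frames to orthonormal frames without changing the matrices
  of frame changes, so the same cocycle of lifts gives the same spin structure for the deformed metric.\<close>
definition dhom_spin ::
    "('a, 'n::finite) metric \<Rightarrow> ('a \<Rightarrow> real^'n) \<Rightarrow> real \<Rightarrow> ('a, 'n, 's::finite, 'i) spin_data \<Rightarrow>
     ('a, 'n, 's, 'i) spin_data" where
  "dhom_spin g \<xi> t \<sigma> = \<sigma>\<lparr>frame := (\<lambda>i k p. dhom_isometry g \<xi> t p (frame \<sigma> i k p))\<rparr>"

text \<open>The lift of the isometry to the spinor bundles sends the spinor with components \<open>\<phi> i\<close> in the lifted
  frame over \<open>frame \<sigma> i\<close> to the spinor with the same components in the lifted frame over the image of
  \<open>frame \<sigma> i\<close> under the isometry; hence it is the identity on components.\<close>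
definition dhom_spinor :: "real \<Rightarrow> ('a, 's, 'i) spinor \<Rightarrow> ('a, 's, 'i) spinor" where
  "dhom_spinor t \<phi> = \<phi>"

end

theory Submission
  imports Defs
begin

text \<open>
  Write \<open>\<eta>\<close> for the 1-form dual to \<open>\<xi>\<close> and \<open>\<nabla>\<close> for the transversal derivative.  The spinorial
  derivative of the deformed metric, in the direction \<open>v\<close> and read off in the same trivialisation, is
    \<open>\<nabla>\<^sub>v \<phi> + t/2 \<eta>(v) \<Omega> \<cdot> \<phi> + sqrt t / 2 \<xi> \<cdot> h(v) \<cdot> \<phi>\<close>,
  so that the deformation leaves \<open>\<nabla>\<close> alone and only rescales the two correction terms
  (\<open>dhom_spin_deriv\<close>).  Tracing over the deformed frame, the powers of \<open>t\<close> in the correction terms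
  cancel against those in the frame.  If \<open>\<nabla>\<^sub>v \<phi> = \<alpha> \<eta>(v) \<xi> \<cdot> \<phi>\<close>, the deformed Dirac operator therefore sends
  \<open>\<phi>\<close> to \<open>- \<alpha>/t \<phi> - 1/2 \<xi> \<cdot> \<Omega> \<cdot> \<phi>\<close> (\<open>dhom_dirac\<close>).

  On a Sasakian manifold \<open>\<Omega>\<close> is \<open>\<nabla>\<close>-parallel (\<open>Omega_parallel\<close>).  Hence \<open>\<nabla>\<close> preserves the eigenbundles
  of \<open>\<Omega>\<close>, as does Clifford multiplication by \<open>\<xi>\<close>, and every component \<open>\<psi>\<^sub>r\<close> of a transversal Killing
  spinor satisfies the same first-order equation (\<open>component_killing\<close>).  Both \<open>\<xi>\<close> and \<open>\<Omega>\<close> act on \<open>\<psi>\<^sub>r\<close>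
  by scalars, so \<open>\<psi>\<^sub>r\<close> is an eigenspinor of the deformed Dirac operator for the eigenvalue
  \<open>(-1)\<^bsup>r+1\<^esup> (2r - m)/2 - \<alpha>/t\<close>.  For \<open>r = 0\<close> this is \<open>m/2 - \<alpha>/t\<close>, for \<open>r = m\<close> it is
  \<open>(-1)\<^bsup>m+1\<^esup> m/2 - \<alpha>/t\<close>, and the parameters \<open>t\<close> of the theorem are the zeros; the sign conditions on \<open>\<alpha>\<close>
  make them positive.

  The spin frames need not contain \<open>\<xi>\<close>.  Both \<open>\<nabla>\<close> and the deformed derivative are compared through
  their connection matrices in an arbitrary orthonormal frame (\<open>transversal_form\<close>,
  \<open>dhom_connection_form\<close>), which act on spinors through \<open>clifford_form\<close>.
\<close>

section \<open>Calculus of smooth functions\<close>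

lemma Ck_on_subset: "Ck_on k f S \<Longrightarrow> T \<subseteq> S \<Longrightarrow> Ck_on k f T"
  by (induction k arbitrary: f) (auto intro: continuous_on_subset)

lemma Ck_on_Suc_imp: "Ck_on (Suc k) f S \<Longrightarrow> Ck_on k f S"
proof (induction k arbitrary: f)
  case 0
  then show ?case
    by (auto intro!: continuous_at_imp_continuous_on differentiable_imp_continuous_within)
next
  case (Suc k)
  have "Ck_on (Suc k) (\<lambda>x. frechet_derivative f (at x) v) S" for v
    using Suc.prems by (subst (asm) Ck_on.simps) blast
  then have "Ck_on k (\<lambda>x. frechet_derivative f (at x) v) S" for v by (rule Suc.IH)
  moreover have "f differentiable (at x)" if "x \<in> S" for x
    using Suc.prems that by (subst (asm) Ck_on.simps) blast
  ultimately show ?case by simp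
qed

lemma frechet_derivative_cong_open:
  assumes "open S" "x \<in> S" "\<And>y. y \<in> S \<Longrightarrow> f y = g y"
  shows "frechet_derivative f (at x) = frechet_derivative g (at x)"
proof -
  have "(f has_derivative D) (at x) \<longleftrightarrow> (g has_derivative D) (at x)" for D
    using has_derivative_transform_within_open[of f D x UNIV S g]
      has_derivative_transform_within_open[of g D x UNIV S f] assms by auto
  then show ?thesis by (simp add: frechet_derivative_def)
qed

lemma Ck_on_cong:
  assumes "open S" "\<And>x. x \<in> S \<Longrightarrow> f x = g x" "Ck_on k f S"
  shows "Ck_on k g S"
  using assms(2,3)
proof (induction k arbitrary: f g)
  case 0
  then show ?case by (auto cong: continuous_on_cong)
next
  case (Suc k)
  have "g differentiable (at x)" if "x \<in> S" for x
  proof -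
    have "f differentiable (at x)" using Suc.prems(2) that by simp
    then obtain D where "(f has_derivative D) (at x)" unfolding differentiable_def by blast
    then have "(g has_derivative D) (at x)"
      by (rule has_derivative_transform_within_open[OF _ assms(1) that]) (use Suc.prems(1) in auto)
    then show ?thesis unfolding differentiable_def by blast
  qed
  moreover have "Ck_on k (\<lambda>x. frechet_derivative g (at x) v) S" for v
  proof (rule Suc.IH[of "\<lambda>x. frechet_derivative f (at x) v"])
    show "frechet_derivative f (at x) v = frechet_derivative g (at x) v" if "x \<in> S" for x
      using frechet_derivative_cong_open[OF assms(1) that Suc.prems(1)] by simp
    show "Ck_on k (\<lambda>x. frechet_derivative f (at x) v) S" using Suc.prems(2) by simp
  qed
  ultimately show ?case by auto
qed

lemma Ck_on_const: "Ck_on k (\<lambda>x. c) S"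
proof (induction k arbitrary: c)
  case (Suc k)
  then show ?case by auto
qed auto

lemma frechet_derivative_add:
  assumes "f differentiable (at x)" "g differentiable (at x)"
  shows "frechet_derivative (\<lambda>x. f x + g x) (at x) v
    = frechet_derivative f (at x) v + frechet_derivative g (at x) v"
  using frechet_derivative_at[OF has_derivative_add[OF assms[unfolded frechet_derivative_works]]]
  by (metis (no_types))

lemma Ck_on_add:
  assumes "open S" "Ck_on k f S" "Ck_on k g S"
  shows "Ck_on k (\<lambda>x. f x + g x) S"
  using assms(2,3)
proof (induction k arbitrary: f g)
  case 0
  then show ?case by (auto intro: continuous_intros)
next
  case (Suc k)
  have "Ck_on k (\<lambda>x. frechet_derivative (\<lambda>x. f x + g x) (at x) v) S" for v
    by (rule Ck_on_cong[OF assms(1) _ Suc.IH[of "\<lambda>x. frechet_derivative f (at x) v"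
            "\<lambda>x. frechet_derivative g (at x) v"]])
      (use Suc.prems in \<open>auto simp: frechet_derivative_add\<close>)
  then show ?case using Suc.prems by auto
qed

lemma frechet_derivative_bilinear:
  assumes "bounded_bilinear B" "f differentiable (at x)" "g differentiable (at x)"
  shows "frechet_derivative (\<lambda>x. B (f x) (g x)) (at x) v
    = B (f x) (frechet_derivative g (at x) v) + B (frechet_derivative f (at x) v) (g x)"
    and "(\<lambda>x. B (f x) (g x)) differentiable (at x)"
proof -
  have "((\<lambda>x. B (f x) (g x)) has_derivative
     (\<lambda>v. B (f x) (frechet_derivative g (at x) v) + B (frechet_derivative f (at x) v) (g x))) (at x)"
    by (rule bounded_bilinear.FDERIV[OF assms(1)])
      (use assms(2,3) frechet_derivative_works in blast)+
  note der = this
  show "frechet_derivative (\<lambda>x. B (f x) (g x)) (at x) v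
    = B (f x) (frechet_derivative g (at x) v) + B (frechet_derivative f (at x) v) (g x)"
    using fun_cong[OF frechet_derivative_at[OF der], of v] by simp
  show "(\<lambda>x. B (f x) (g x)) differentiable (at x)"
    using der unfolding differentiable_def by blast
qed

text \<open>
  The product rule expresses the derivative through \<open>f\<close>, \<open>g\<close> and their derivatives, all of which are of
  class \<open>C\<^sup>k\<close> if \<open>f\<close> and \<open>g\<close> are of class \<open>C\<^bsup>k+1\<^esup>\<close>; hence the induction on \<open>k\<close>.
\<close>

lemma Ck_on_bilinear:
  assumes B: "bounded_bilinear B" and "open S" "Ck_on k f S" "Ck_on k g S"
  shows "Ck_on k (\<lambda>x. B (f x) (g x)) S"
  using assms(3,4)
proof (induction k arbitrary: f g)
  case 0
  then show ?case by (auto intro: bounded_bilinear.continuous_on[OF B])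
next
  case (Suc k)
  have "Ck_on k (\<lambda>x. frechet_derivative (\<lambda>x. B (f x) (g x)) (at x) v) S" for v
  proof (rule Ck_on_cong[OF assms(2) _ Ck_on_add[OF assms(2) Suc.IH[of f "\<lambda>x. frechet_derivative g (at x) v"]
            Suc.IH[of "\<lambda>x. frechet_derivative f (at x) v" g]]])
    show "Ck_on k f S" "Ck_on k g S" using Suc.prems Ck_on_Suc_imp by blast+
    show "Ck_on k (\<lambda>x. frechet_derivative f (at x) v) S" "Ck_on k (\<lambda>x. frechet_derivative g (at x) v) S"
      using Suc.prems by auto
  qed (use Suc.prems in \<open>auto simp: frechet_derivative_bilinear(1)[OF B]\<close>)
  moreover have "(\<lambda>x. B (f x) (g x)) differentiable (at x)" if "x \<in> S" for x
    using Suc.prems that by (intro frechet_derivative_bilinear(2)[OF B]) auto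
  ultimately show ?case by simp
qed

section \<open>Smooth functions and vector fields on a manifold\<close>

lemma open_chart_image:
  assumes "smooth_manifold M" "open U"
  shows "open (chart M p ` (chart_dom M p \<inter> U))"
proof -
  have h: "homeomorphism (chart_dom M p) (chart M p ` chart_dom M p) (chart M p) (inv_chart M p)"
    and o: "open (chart M p ` chart_dom M p)"
    using assms(1) unfolding smooth_manifold_def by blast+
  have "chart M p ` (chart_dom M p \<inter> U) = chart M p ` chart_dom M p \<inter> inv_chart M p -` U"
    using h unfolding homeomorphism_def by force
  then show ?thesis
    using continuous_open_preimage[OF homeomorphism_cont2[OF h] o assms(2)] by simp
qed

lemma inv_chart_apply:
  assumes "smooth_manifold M" "q \<in> chart_dom M p"
  shows "inv_chart M p (chart M p q) = q"
  using assms unfolding smooth_manifold_def homeomorphism_def by blast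

lemma smooth_map_differentiable:
  assumes "smooth_manifold M" "smooth_map M U f" "p \<in> U"
  shows "(f \<circ> inv_chart M p) differentiable (at (chart M p p))"
proof -
  have "Ck_on (Suc 0) (f \<circ> inv_chart M p) (chart M p ` (chart_dom M p \<inter> U))"
    using assms(2) unfolding smooth_map_def smooth_on_def by blast
  then have "\<forall>x\<in>chart M p ` (chart_dom M p \<inter> U). (f \<circ> inv_chart M p) differentiable (at x)"
    unfolding Ck_on.simps by blast
  moreover have "p \<in> chart_dom M p" using assms(1) unfolding smooth_manifold_def by blast
  ultimately show ?thesis using assms(3) by blast
qed

lemma smooth_vf_subset: "smooth_vf M U X \<Longrightarrow> V \<subseteq> U \<Longrightarrow> smooth_vf M V X"
  unfolding smooth_vf_def smooth_on_def
  by (intro allI, rule Ck_on_subset[where S = "chart M p ` (chart_dom M p \<inter> U)" for p]) auto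

lemma smooth_map_const: "smooth_map M U (\<lambda>q. c)"
  unfolding smooth_map_def smooth_on_def o_def by (simp add: Ck_on_const)

lemma smooth_map_cong:
  assumes M: "smooth_manifold M" and U: "open U" and eq: "\<And>q. q \<in> U \<Longrightarrow> f q = f' q"
    and f: "smooth_map M U f"
  shows "smooth_map M U f'"
  unfolding smooth_map_def smooth_on_def
proof (intro allI)
  fix p k
  show "Ck_on k (f' \<circ> inv_chart M p) (chart M p ` (chart_dom M p \<inter> U))"
    by (rule Ck_on_cong[OF open_chart_image[OF M U], where f = "f \<circ> inv_chart M p"])
      (use f eq inv_chart_apply[OF M] in \<open>auto simp: smooth_map_def smooth_on_def\<close>)
qed

lemma smooth_map_add:
  assumes "smooth_manifold M" "open U" "smooth_map M U f" "smooth_map M U f'"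
  shows "smooth_map M U (\<lambda>q. f q + f' q)"
  unfolding smooth_map_def smooth_on_def o_def
proof (intro allI)
  fix p k
  show "Ck_on k (\<lambda>u. f (inv_chart M p u) + f' (inv_chart M p u)) (chart M p ` (chart_dom M p \<inter> U))"
    using assms(3,4) unfolding smooth_map_def smooth_on_def o_def
    by (intro Ck_on_add open_chart_image[OF assms(1,2)]) auto
qed

lemma smooth_map_bilinear:
  assumes "bounded_bilinear B" "smooth_manifold M" "open U" "smooth_map M U f" "smooth_map M U f'"
  shows "smooth_map M U (\<lambda>q. B (f q) (f' q))"
  unfolding smooth_map_def smooth_on_def o_def
proof (intro allI)
  fix p k
  show "Ck_on k (\<lambda>u. B (f (inv_chart M p u)) (f' (inv_chart M p u)))
      (chart M p ` (chart_dom M p \<inter> U))"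
    using assms(4,5) unfolding smooth_map_def smooth_on_def o_def
    by (intro Ck_on_bilinear[OF assms(1)] open_chart_image[OF assms(2,3)]) auto
qed

lemma smooth_map_sum:
  assumes "smooth_manifold M" "open U" "\<And>x. x \<in> A \<Longrightarrow> smooth_map M U (f x)"
  shows "smooth_map M U (\<lambda>q. \<Sum>x\<in>A. f x q)"
  using assms(3)
  by (induction A rule: infinite_finite_induct)
    (auto simp: smooth_map_const intro!: smooth_map_add[OF assms(1,2)])

lemma frechet_chart_change_linear:
  assumes "smooth_manifold M" "q \<in> chart_dom M p"
  shows "linear (frechet_derivative (chart_change M q p) (at (chart M q q)))"
proof -
  have "smooth_on (chart_change M q p) (chart M q ` (chart_dom M q \<inter> chart_dom M p))"
    and "q \<in> chart_dom M q"
    using assms(1) unfolding smooth_manifold_def by blast+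
  then have "Ck_on (Suc 0) (chart_change M q p) (chart M q ` (chart_dom M q \<inter> chart_dom M p))"
    and "chart M q q \<in> chart M q ` (chart_dom M q \<inter> chart_dom M p)"
    using assms(2) unfolding smooth_on_def by blast+
  then have "chart_change M q p differentiable (at (chart M q q))"
    unfolding Ck_on.simps by blast
  then show ?thesis by (rule linear_frechet_derivative)
qed

text \<open>
  In a fixed chart the components of a field depend linearly on its values, the transition being the
  derivative of a change of charts.
\<close>

lemma smooth_vf_combination:
  assumes M: "smooth_manifold M" and U: "open U"
    and X: "smooth_vf M U X" and f: "smooth_map M U f" and Y: "smooth_vf M U Y"
  shows "smooth_vf M U (\<lambda>q. X q + f q *\<^sub>R Y q)"
  unfolding smooth_vf_def smooth_on_def
proof (intro allI)
  fix p k
  let ?S = "chart M p ` (chart_dom M p \<inter> U)"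
  show "Ck_on k (chart_rep M p (\<lambda>q. X q + f q *\<^sub>R Y q)) ?S"
  proof (rule Ck_on_cong[OF open_chart_image[OF M U]])
    show "Ck_on k (\<lambda>u. chart_rep M p X u + (f \<circ> inv_chart M p) u *\<^sub>R chart_rep M p Y u) ?S"
      using X Y f unfolding smooth_vf_def smooth_map_def smooth_on_def
      by (intro Ck_on_add Ck_on_bilinear[OF bounded_bilinear_scaleR] open_chart_image[OF M U]) blast+
    fix u assume "u \<in> ?S"
    then have "inv_chart M p u \<in> chart_dom M p" using inv_chart_apply[OF M] by auto
    from frechet_chart_change_linear[OF M this]
    show "chart_rep M p X u + (f \<circ> inv_chart M p) u *\<^sub>R chart_rep M p Y u
        = chart_rep M p (\<lambda>q. X q + f q *\<^sub>R Y q) u"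
      by (simp add: chart_rep_def Let_def linear_add linear_scale)
  qed
qed

lemma smooth_vf_zero:
  assumes M: "smooth_manifold M" and U: "open U"
  shows "smooth_vf M U (\<lambda>q. 0)"
  unfolding smooth_vf_def smooth_on_def
proof (intro allI)
  fix p k
  let ?S = "chart M p ` (chart_dom M p \<inter> U)"
  show "Ck_on k (chart_rep M p (\<lambda>q. 0)) ?S"
  proof (rule Ck_on_cong[OF open_chart_image[OF M U] _ Ck_on_const[of k 0]])
    fix u assume "u \<in> ?S"
    then have "inv_chart M p u \<in> chart_dom M p" using inv_chart_apply[OF M] by auto
    from frechet_chart_change_linear[OF M this]
    show "0 = chart_rep M p (\<lambda>q. 0) u"
      by (simp add: chart_rep_def Let_def linear_0)
  qed
qed

lemma dir_deriv_cong:
  assumes M: "smooth_manifold M" and U: "open U" "p \<in> U" and eq: "\<And>q. q \<in> U \<Longrightarrow> f q = f' q"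
  shows "dir_deriv M f p v = dir_deriv M f' p v"
proof -
  have "p \<in> chart_dom M p" using M unfolding smooth_manifold_def by blast
  then show ?thesis
    unfolding dir_deriv_def using U eq inv_chart_apply[OF M]
    by (subst frechet_derivative_cong_open[OF open_chart_image[OF M U(1)],
          of _ p "f \<circ> inv_chart M p" "f' \<circ> inv_chart M p"]) auto
qed

lemma dir_deriv_const: "dir_deriv M (\<lambda>q. c) p v = 0"
  by (simp add: dir_deriv_def o_def)

lemma dir_deriv_linear:
  assumes "smooth_manifold M" "smooth_map M U f" "p \<in> U"
  shows "linear (dir_deriv M f p)"
  using linear_frechet_derivative[OF smooth_map_differentiable[OF assms]]
  unfolding dir_deriv_def[abs_def] .

lemma dir_deriv_add:
  assumes "smooth_manifold M" "p \<in> U" "smooth_map M U f" "smooth_map M U f'"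
  shows "dir_deriv M (\<lambda>q. f q + f' q) p v = dir_deriv M f p v + dir_deriv M f' p v"
  using smooth_map_differentiable[OF assms(1,3,2)] smooth_map_differentiable[OF assms(1,4,2)]
  by (simp add: dir_deriv_def o_def frechet_derivative_add)

lemma dir_deriv_bilinear:
  assumes B: "bounded_bilinear B" and M: "smooth_manifold M" and p: "p \<in> U"
    and f: "smooth_map M U f" and f': "smooth_map M U f'"
  shows "dir_deriv M (\<lambda>q. B (f q) (f' q)) p v
    = B (f p) (dir_deriv M f' p v) + B (dir_deriv M f p v) (f' p)"
proof -
  have "p \<in> chart_dom M p" using M unfolding smooth_manifold_def by blast
  then show ?thesis
    using frechet_derivative_bilinear(1)[OF B smooth_map_differentiable[OF M f p]
        smooth_map_differentiable[OF M f' p]] inv_chart_apply[OF M]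
    by (simp add: dir_deriv_def o_def)
qed

lemma dir_deriv_sum:
  assumes "smooth_manifold M" "open U" "p \<in> U" "\<And>x. x \<in> A \<Longrightarrow> smooth_map M U (f x)"
  shows "dir_deriv M (\<lambda>q. \<Sum>x\<in>A. f x q) p v = (\<Sum>x\<in>A. dir_deriv M (f x) p v)"
  using assms(4)
proof (induction A rule: infinite_finite_induct)
  case (insert x A)
  then show ?case
    by (simp add: dir_deriv_add[OF assms(1,3)] smooth_map_sum[OF assms(1,2)])
qed (auto simp: dir_deriv_const)

section \<open>Clifford algebra\<close>

lemma bounded_bilinear_matrix_matrix:
  "bounded_bilinear ((**) :: complex^'s::finite^'s \<Rightarrow> complex^'s^'s \<Rightarrow> complex^'s^'s)"
  unfolding bilinear_conv_bounded_bilinear[symmetric] bilinear_def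
  by (auto intro!: linearI simp: vec_eq_iff matrix_matrix_mult_def sum.distrib scaleR_sum_right
      distrib_left distrib_right)

lemma bounded_bilinear_matrix_vector:
  "bounded_bilinear ((*v) :: complex^'s::finite^'s \<Rightarrow> complex^'s \<Rightarrow> complex^'s)"
  unfolding bilinear_conv_bounded_bilinear[symmetric] bilinear_def
  by (auto intro!: linearI simp: vec_eq_iff matrix_vector_mult_def sum.distrib scaleR_sum_right
      distrib_left distrib_right)

interpretation mm: bounded_bilinear "(**) :: complex^'s::finite^'s \<Rightarrow> complex^'s^'s \<Rightarrow> complex^'s^'s"
  by (rule bounded_bilinear_matrix_matrix)

interpretation mv: bounded_bilinear "(*v) :: complex^'s::finite^'s \<Rightarrow> complex^'s \<Rightarrow> complex^'s"
  by (rule bounded_bilinear_matrix_vector)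

text \<open>
  On skew-symmetric \<open>A\<close> this is, up to the factor 4, the isomorphism of the orthogonal Lie algebra with
  the Lie algebra of the spin group: a connection with matrix \<open>A\<close> in an orthonormal frame acts on
  spinors through a quarter of it.
\<close>

definition clifford_form ::
    "('n::finite \<Rightarrow> complex^'s::finite^'s) \<Rightarrow> ('n \<Rightarrow> 'n \<Rightarrow> real) \<Rightarrow> complex^'s^'s" where
  "clifford_form \<gamma> A = (\<Sum>k\<in>UNIV. \<Sum>l\<in>UNIV. A k l *\<^sub>R (\<gamma> k ** \<gamma> l))"

lemma clifford_form_add:
  "clifford_form \<gamma> (\<lambda>k l. A k l + B k l) = clifford_form \<gamma> A + clifford_form \<gamma> B"
  by (simp add: clifford_form_def scaleR_add_left sum.distrib)

lemma clifford_form_scale: "clifford_form \<gamma> (\<lambda>k l. c * A k l) = c *\<^sub>R clifford_form \<gamma> A"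
  by (simp add: clifford_form_def scaleR_sum_right)

lemma clifford_form_tensor: "clifford_form \<gamma> (\<lambda>k l. x $ k * y $ l) = cliff \<gamma> x ** cliff \<gamma> y"
  by (simp add: clifford_form_def cliff_def mm.sum_left mm.sum_right mm.scaleR_left mm.scaleR_right
      scaleR_sum_right)
    (subst sum.swap, simp add: mult.commute)

lemma clifford_swap:
  assumes "clifford_rep \<gamma>"
  shows "\<gamma> k ** \<gamma> l = - (\<gamma> l ** \<gamma> k) - (2 * of_bool (k = l)) *\<^sub>R mat 1"
proof -
  have "\<gamma> k ** \<gamma> l + \<gamma> l ** \<gamma> k = - ((2 * of_bool (k = l)) *\<^sub>R mat 1)"
    using assms unfolding clifford_rep_def by (auto simp: vec_eq_iff mat_def scaleR_conv_of_real)
  then have "\<gamma> k ** \<gamma> l = - ((2 * of_bool (k = l)) *\<^sub>R mat 1) - \<gamma> l ** \<gamma> k"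
    by (simp only: eq_diff_eq)
  then show ?thesis by (simp only: minus_diff_commute)
qed

lemma cliff_anticommute:
  assumes "clifford_rep \<gamma>"
  shows "cliff \<gamma> x ** cliff \<gamma> y = - (cliff \<gamma> y ** cliff \<gamma> x) - (2 * (x \<bullet> y)) *\<^sub>R mat 1"
proof -
  have "cliff \<gamma> x ** cliff \<gamma> y = (\<Sum>k\<in>UNIV. \<Sum>l\<in>UNIV. (x $ k * y $ l) *\<^sub>R (\<gamma> k ** \<gamma> l))"
    by (simp add: clifford_form_tensor[symmetric] clifford_form_def)
  also have "\<dots> = (\<Sum>k\<in>UNIV. \<Sum>l\<in>UNIV. - ((x $ k * y $ l) *\<^sub>R (\<gamma> l ** \<gamma> k))
      - (2 * (x $ k * y $ l * of_bool (k = l))) *\<^sub>R mat 1)"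
    by (subst clifford_swap[OF assms]) (simp add: algebra_simps)
  also have "\<dots> = - (\<Sum>k\<in>UNIV. \<Sum>l\<in>UNIV. (x $ k * y $ l) *\<^sub>R (\<gamma> l ** \<gamma> k))
      - (\<Sum>k\<in>UNIV. \<Sum>l\<in>UNIV. (2 * (x $ k * y $ l * of_bool (k = l))) *\<^sub>R mat 1)"
    by (simp add: sum_subtractf sum_negf)
  also have "(\<Sum>k\<in>UNIV. \<Sum>l\<in>UNIV. (x $ k * y $ l) *\<^sub>R (\<gamma> l ** \<gamma> k))
      = (\<Sum>l\<in>UNIV. \<Sum>k\<in>UNIV. (y $ l * x $ k) *\<^sub>R (\<gamma> l ** \<gamma> k))"
    by (subst sum.swap) (simp add: mult.commute)
  also have "(\<Sum>l\<in>UNIV. \<Sum>k\<in>UNIV. (y $ l * x $ k) *\<^sub>R (\<gamma> l ** \<gamma> k)) = cliff \<gamma> y ** cliff \<gamma> x"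
    by (simp add: clifford_form_tensor[symmetric] clifford_form_def)
  also have "(\<Sum>k\<in>UNIV. \<Sum>l\<in>UNIV. (2 * (x $ k * y $ l * of_bool (k = l))) *\<^sub>R mat 1)
      = (2 * (x \<bullet> y)) *\<^sub>R (mat 1 :: complex^'b^'b)"
    by (simp only: scaleR_sum_left[symmetric])
      (simp add: inner_vec_def sum_distrib_left of_bool_def if_distrib cong: if_cong)
  finally show ?thesis .
qed

text \<open>
  Moving \<open>\<gamma> j\<close> past \<open>\<gamma> k ** \<gamma> l\<close> by two applications of the Clifford relation leaves one term for \<open>k = j\<close>
  and one for \<open>l = j\<close>; skew-symmetry makes them add up.  Thus a quarter of \<open>clifford_form \<gamma> A\<close> acts on
  vectors, by commutators, as the endomorphism with matrix \<open>A\<close>.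
\<close>

lemma commutator_clifford_form_generator:
  assumes "clifford_rep \<gamma>" and A: "\<And>k l. A k l = - A l k"
  shows "clifford_form \<gamma> A ** \<gamma> j = \<gamma> j ** clifford_form \<gamma> A + 4 *\<^sub>R (\<Sum>l\<in>UNIV. A j l *\<^sub>R \<gamma> l)"
proof -
  have cubic: "\<gamma> k ** \<gamma> l ** \<gamma> j = \<gamma> j ** (\<gamma> k ** \<gamma> l)
      + (2 * of_bool (k = j)) *\<^sub>R \<gamma> l - (2 * of_bool (l = j)) *\<^sub>R \<gamma> k" for k l
  proof -
    have "\<gamma> k ** \<gamma> l ** \<gamma> j = \<gamma> k ** (\<gamma> l ** \<gamma> j)" by (simp add: matrix_mul_assoc)
    also have "\<dots> = - (\<gamma> k ** \<gamma> j ** \<gamma> l) - (2 * of_bool (l = j)) *\<^sub>R \<gamma> k"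
      by (subst clifford_swap[OF assms(1), of l j])
        (simp add: mm.diff_right mm.minus_right mm.scaleR_right matrix_mul_assoc)
    also have "\<gamma> k ** \<gamma> j ** \<gamma> l = - (\<gamma> j ** (\<gamma> k ** \<gamma> l)) - (2 * of_bool (k = j)) *\<^sub>R \<gamma> l"
      by (subst clifford_swap[OF assms(1), of k j])
        (simp add: mm.diff_left mm.minus_left mm.scaleR_left matrix_mul_assoc)
    finally show ?thesis by (simp add: algebra_simps)
  qed
  have "clifford_form \<gamma> A ** \<gamma> j = (\<Sum>k\<in>UNIV. \<Sum>l\<in>UNIV. A k l *\<^sub>R (\<gamma> k ** \<gamma> l ** \<gamma> j))"
    by (simp add: clifford_form_def mm.sum_left mm.scaleR_left)
  also have "\<dots> = (\<Sum>k\<in>UNIV. \<Sum>l\<in>UNIV. A k l *\<^sub>R (\<gamma> j ** (\<gamma> k ** \<gamma> l)))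
      + (\<Sum>k\<in>UNIV. \<Sum>l\<in>UNIV. (2 * (A k l * of_bool (k = j))) *\<^sub>R \<gamma> l)
      - (\<Sum>k\<in>UNIV. \<Sum>l\<in>UNIV. (2 * (A k l * of_bool (l = j))) *\<^sub>R \<gamma> k)"
    by (simp only: cubic scaleR_add_right scaleR_diff_right sum.distrib sum_subtractf scaleR_scaleR mult_ac)
  also have "(\<Sum>k\<in>UNIV. \<Sum>l\<in>UNIV. A k l *\<^sub>R (\<gamma> j ** (\<gamma> k ** \<gamma> l))) = \<gamma> j ** clifford_form \<gamma> A"
    by (simp add: clifford_form_def mm.sum_right mm.scaleR_right)
  also have "(\<Sum>k\<in>UNIV. \<Sum>l\<in>UNIV. (2 * (A k l * of_bool (k = j))) *\<^sub>R \<gamma> l)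
      = 2 *\<^sub>R (\<Sum>l\<in>UNIV. A j l *\<^sub>R \<gamma> l)"
    by (subst sum.swap) (simp add: of_bool_def if_distrib if_distribR scaleR_sum_right cong: if_cong)
  also have "(\<Sum>k\<in>UNIV. \<Sum>l\<in>UNIV. (2 * (A k l * of_bool (l = j))) *\<^sub>R \<gamma> k)
      = - (2 *\<^sub>R (\<Sum>l\<in>UNIV. A j l *\<^sub>R \<gamma> l))"
    by (subst A) (simp add: of_bool_def if_distrib if_distribR scaleR_sum_right sum_negf cong: if_cong)
  finally show ?thesis by (simp add: scaleR_sum_right algebra_simps sum.distrib[symmetric] flip: scaleR_add_left)
qed

text \<open>
  The commutator is a derivation, so this is the previous rule applied to both factors of
  \<open>\<gamma> k ** \<gamma> l\<close>.  The right-hand side is the action of the endomorphism \<open>A\<close> on the bilinear form \<open>B\<close>, and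
  it is what turns a covariant derivative of a 2-form into a commutator on spinors.
\<close>

lemma commutator_clifford_forms:
  assumes "clifford_rep \<gamma>" and A: "\<And>k l. A k l = - A l k"
  shows "clifford_form \<gamma> A ** clifford_form \<gamma> B = clifford_form \<gamma> B ** clifford_form \<gamma> A
    - 4 *\<^sub>R clifford_form \<gamma> (\<lambda>k l. \<Sum>a\<in>UNIV. A k a * B a l + A l a * B k a)"
proof -
  have quartic: "clifford_form \<gamma> A ** (\<gamma> k ** \<gamma> l) = \<gamma> k ** \<gamma> l ** clifford_form \<gamma> A
      + 4 *\<^sub>R (\<Sum>a\<in>UNIV. A k a *\<^sub>R (\<gamma> a ** \<gamma> l)) + 4 *\<^sub>R (\<Sum>a\<in>UNIV. A l a *\<^sub>R (\<gamma> k ** \<gamma> a))" for k l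
  proof -
    have "clifford_form \<gamma> A ** (\<gamma> k ** \<gamma> l)
        = \<gamma> k ** (clifford_form \<gamma> A ** \<gamma> l) + 4 *\<^sub>R (\<Sum>a\<in>UNIV. A k a *\<^sub>R (\<gamma> a ** \<gamma> l))"
      by (simp add: matrix_mul_assoc commutator_clifford_form_generator[OF assms, where j = k] mm.add_left
          mm.scaleR_left mm.sum_left scaleR_sum_right)
    then show ?thesis
      by (simp add: commutator_clifford_form_generator[OF assms, where j = l] mm.add_right
          mm.scaleR_right mm.sum_right scaleR_sum_right matrix_mul_assoc)
  qed
  let ?G = "\<lambda>B. (\<Sum>k\<in>UNIV. \<Sum>l\<in>UNIV. B k l *\<^sub>R (\<gamma> k ** \<gamma> l))"
  have 1: "(\<Sum>k\<in>UNIV. \<Sum>l\<in>UNIV. B k l *\<^sub>R (\<Sum>a\<in>UNIV. A k a *\<^sub>R (\<gamma> a ** \<gamma> l)))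
      = - ?G (\<lambda>k l. \<Sum>a\<in>UNIV. A k a * B a l)"
  proof -
    have "(\<Sum>k\<in>UNIV. \<Sum>l\<in>UNIV. B k l *\<^sub>R (\<Sum>a\<in>UNIV. A k a *\<^sub>R (\<gamma> a ** \<gamma> l)))
      = (\<Sum>k\<in>UNIV. \<Sum>a\<in>UNIV. \<Sum>l\<in>UNIV. (B k l * A k a) *\<^sub>R (\<gamma> a ** \<gamma> l))"
      by (simp add: scaleR_sum_right) (intro sum.cong refl sum.swap)
    also have "\<dots> = (\<Sum>a\<in>UNIV. \<Sum>k\<in>UNIV. \<Sum>l\<in>UNIV. (B k l * A k a) *\<^sub>R (\<gamma> a ** \<gamma> l))"
      by (rule sum.swap)
    also have "\<dots> = (\<Sum>a\<in>UNIV. \<Sum>l\<in>UNIV. \<Sum>k\<in>UNIV. (B k l * A k a) *\<^sub>R (\<gamma> a ** \<gamma> l))"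
      by (intro sum.cong refl sum.swap)
    also have "\<dots> = (\<Sum>a\<in>UNIV. \<Sum>l\<in>UNIV. \<Sum>k\<in>UNIV. (- (A a k * B k l)) *\<^sub>R (\<gamma> a ** \<gamma> l))"
      by (subst A) (simp add: mult.commute)
    finally show ?thesis by (simp add: scaleR_sum_left sum_negf)
  qed
  have 2: "(\<Sum>k\<in>UNIV. \<Sum>l\<in>UNIV. B k l *\<^sub>R (\<Sum>a\<in>UNIV. A l a *\<^sub>R (\<gamma> k ** \<gamma> a)))
      = - ?G (\<lambda>k l. \<Sum>a\<in>UNIV. A l a * B k a)"
  proof -
    have "(\<Sum>k\<in>UNIV. \<Sum>l\<in>UNIV. B k l *\<^sub>R (\<Sum>a\<in>UNIV. A l a *\<^sub>R (\<gamma> k ** \<gamma> a)))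
      = (\<Sum>k\<in>UNIV. \<Sum>a\<in>UNIV. \<Sum>l\<in>UNIV. (B k l * A l a) *\<^sub>R (\<gamma> k ** \<gamma> a))"
      by (simp add: scaleR_sum_right) (intro sum.cong refl sum.swap)
    also have "\<dots> = (\<Sum>k\<in>UNIV. \<Sum>a\<in>UNIV. \<Sum>l\<in>UNIV. (- (A a l * B k l)) *\<^sub>R (\<gamma> k ** \<gamma> a))"
      by (subst A) (simp add: mult.commute)
    finally show ?thesis by (simp add: scaleR_sum_left sum_negf)
  qed
  have "clifford_form \<gamma> A ** clifford_form \<gamma> B
      = (\<Sum>k\<in>UNIV. \<Sum>l\<in>UNIV. B k l *\<^sub>R (clifford_form \<gamma> A ** (\<gamma> k ** \<gamma> l)))"
    by (simp add: clifford_form_def[of \<gamma> B] mm.sum_right mm.scaleR_right)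
  also have "\<dots> = clifford_form \<gamma> B ** clifford_form \<gamma> A
      + 4 *\<^sub>R (\<Sum>k\<in>UNIV. \<Sum>l\<in>UNIV. B k l *\<^sub>R (\<Sum>a\<in>UNIV. A k a *\<^sub>R (\<gamma> a ** \<gamma> l)))
      + 4 *\<^sub>R (\<Sum>k\<in>UNIV. \<Sum>l\<in>UNIV. B k l *\<^sub>R (\<Sum>a\<in>UNIV. A l a *\<^sub>R (\<gamma> k ** \<gamma> a)))"
    by (simp add: quartic scaleR_add_right sum.distrib clifford_form_def[of \<gamma> B] mm.sum_left mm.scaleR_left
        scaleR_sum_right mult_ac)
  also have "\<dots> = clifford_form \<gamma> B ** clifford_form \<gamma> A
      - 4 *\<^sub>R clifford_form \<gamma> (\<lambda>k l. \<Sum>a\<in>UNIV. A k a * B a l + A l a * B k a)"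
    by (simp add: 1 2 clifford_form_add sum.distrib) (simp add: clifford_form_def algebra_simps)
  finally show ?thesis .
qed

text \<open>
  Applying \<open>A - \<mu> s\<close> to the relation removes \<open>w s\<close> and multiplies the other vectors by nonzero
  factors.
\<close>

lemma eigenvectors_independent:
  fixes A :: "complex^'s::finite^'s"
  assumes "finite I" "inj_on \<mu> I" "\<And>r. r \<in> I \<Longrightarrow> A *v w r = \<mu> r *s w r" "(\<Sum>r\<in>I. w r) = 0" "r \<in> I"
  shows "w r = 0"
  using assms
proof (induction I arbitrary: w r rule: finite_induct)
  case (insert s I)
  have z: "(\<mu> r - \<mu> s) *s w r = 0" if "r \<in> I" for r
  proof (rule insert.IH[OF _ _ _ that])
    show "inj_on \<mu> I" using insert.prems(1) by auto
    show "A *v ((\<mu> r - \<mu> s) *s w r) = \<mu> r *s ((\<mu> r - \<mu> s) *s w r)" if "r \<in> I" for r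
      using insert.prems(2)[of r] that
      by (simp only: vector_scalar_commute vector_smult_assoc mult.commute insertI2)
    have "0 = A *v (\<Sum>r\<in>insert s I. w r) - \<mu> s *s (\<Sum>r\<in>insert s I. w r)"
      using insert.prems(3) by simp
    also have "\<dots> = (\<Sum>r\<in>insert s I. A *v w r - \<mu> s *s w r)"
      by (simp only: mv.sum_right sum_subtractf vec.scale_sum_right)
    also have "\<dots> = (\<Sum>r\<in>insert s I. (\<mu> r - \<mu> s) *s w r)"
      using insert.prems(2) by (intro sum.cong refl) (simp add: vec.scale_left_diff_distrib)
    finally show "(\<Sum>r\<in>I. (\<mu> r - \<mu> s) *s w r) = 0"
      using insert.hyps by simp
  qed
  have "w r = 0" if "r \<in> I" for r
    using z[OF that] that insert.prems(1) insert.hyps(2) by (auto simp: inj_on_def)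
  then show ?case using insert.prems(3,4) insert.hyps by auto
qed simp

section \<open>Riemannian flows\<close>

lemma orthonormal_expansion:
  fixes b :: "'n::finite \<Rightarrow> real^'n"
  assumes G: "bounded_bilinear G" and on: "\<And>k l. G (b k) (b l) = (if k = l then 1 else (0::real))"
  shows "v = (\<Sum>k\<in>UNIV. G v (b k) *\<^sub>R b k)"
proof -
  interpret G: bounded_bilinear G by (rule G)
  define T where "T x = (\<Sum>k\<in>UNIV. x $ k *\<^sub>R b k)" for x :: "real^'n"
  have lin: "linear T"
    by (rule linearI) (simp_all add: T_def scaleR_add_left sum.distrib scaleR_sum_right)
  have coord: "G (T x) (b l) = x $ l" for x l
    by (simp add: T_def G.sum_left G.scaleR_left on if_distrib cong: if_cong)
  \<comment> \<open>A linear injection of the coordinate space into itself is onto, so the frame spans.\<close>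
  have "inj T" using coord by (intro injI) (metis vec_eq_iff)
  then obtain x where "v = T x"
    using linear_injective_imp_surjective[OF lin] unfolding surj_def by blast
  then show ?thesis using coord[of x] by (simp add: T_def)
qed

text \<open>
  The function \<open>g(e k, e l)\<close> is constant on \<open>U\<close>, so its derivative vanishes.
\<close>

lemma connection_form_skew:
  assumes M: "smooth_manifold M" and lc: "levi_civita M g D" and U: "open U" "p \<in> U"
    and e: "\<And>k. smooth_vf M U (e k)"
    and on: "\<And>q k l. q \<in> U \<Longrightarrow> g q (e k q) (e l q) = (if k = l then 1 else 0)"
    and sym: "\<And>v w. g p v w = g p w v"
  shows "g p (D p v (e k)) (e l p) = - g p (D p v (e l)) (e k p)"
proof -
  have "dir_deriv M (\<lambda>q. g q (e k q) (e l q)) p v = 0"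
    using dir_deriv_cong[OF M U, of "\<lambda>q. g q (e k q) (e l q)" "\<lambda>q. if k = l then 1 else 0"] on
    by (simp add: dir_deriv_const)
  moreover have "dir_deriv M (\<lambda>q. g q (e k q) (e l q)) p v
      = g p (D p v (e k)) (e l p) + g p (e k p) (D p v (e l))"
    using lc U e unfolding levi_civita_def by blast
  ultimately show ?thesis using sym by simp
qed

lemma smooth_vf_sum:
  assumes "smooth_manifold M" "open U" "\<And>k. k \<in> A \<Longrightarrow> smooth_vf M U (X k)"
  shows "smooth_vf M U (\<lambda>q. \<Sum>k\<in>A. c k *\<^sub>R X k q)"
  using assms(3)
proof (induction A rule: infinite_finite_induct)
  case (insert k A)
  then have "smooth_vf M U (\<lambda>q. (\<Sum>k\<in>A. c k *\<^sub>R X k q) + c k *\<^sub>R X k q)"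
    by (intro smooth_vf_combination[OF assms(1,2)] smooth_map_const) auto
  then show ?case using insert.hyps by (simp add: add.commute)
qed (simp_all add: smooth_vf_zero[OF assms(1,2)])

locale spin_flow =
  fixes M :: "('a::{t2_space,second_countable_topology}, 'n::finite) atlas"
    and g :: "('a, 'n) metric" and D :: "('a, 'n) connection" and \<xi> :: "'a \<Rightarrow> real^'n"
    and \<sigma> :: "('a, 'n, 's::finite, 'i) spin_data"
  assumes M: "smooth_manifold M" and metric: "riemannian_metric M g" and lc: "levi_civita M g D"
    and flow: "riemannian_flow M g \<xi>" and geodesic: "\<And>p. D p (\<xi> p) \<xi> = 0"
    and spin: "spin_structure M g \<sigma>"
begin

abbreviation "h p v \<equiv> D p v \<xi>"
abbreviation "e i k p \<equiv> frame \<sigma> i k p"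
abbreviation "\<gamma> \<equiv> gam \<sigma>"
abbreviation "C \<equiv> clifford_mult g \<sigma>"
abbreviation "\<Omega> \<equiv> Omega_cliff g D \<xi> \<sigma>"

lemma g_sym: "g p v w = g p w v"
  using metric unfolding riemannian_metric_def by blast

sublocale g: bounded_bilinear "g p" for p
  using metric unfolding riemannian_metric_def bilinear_conv_bounded_bilinear by blast

lemma xi_smooth: "smooth_vf M U \<xi>"
  using flow smooth_vf_subset unfolding riemannian_flow_def by blast

lemma xi_unit: "g p (\<xi> p) (\<xi> p) = 1"
  using flow unfolding riemannian_flow_def by blast

lemma D_linear:
  assumes "open U" "smooth_vf M U Y" "p \<in> U"
  shows "linear (\<lambda>v. D p v Y)"
  using lc[unfolded levi_civita_def affine_connection_def, THEN conjunct1, THEN spec, THEN spec,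
      THEN mp, OF conjI[OF assms(1,2)], THEN conjunct1] assms(3)
  by (rule bspec)

sublocale h: linear "h p" for p
  by (rule D_linear[OF open_UNIV xi_smooth UNIV_I])

lemma D_smooth:
  assumes "open U" "smooth_vf M U X" "smooth_vf M U Y"
  shows "smooth_vf M U (\<lambda>q. D q (X q) Y)"
  by (rule lc[unfolded levi_civita_def affine_connection_def, THEN conjunct1, THEN spec, THEN spec,
      THEN mp, OF conjI[OF assms(1,3)], THEN conjunct2, THEN conjunct1, THEN spec, THEN mp, OF assms(2)])

lemma g_smooth:
  assumes "open U" "smooth_vf M U X" "smooth_vf M U Y"
  shows "smooth_map M U (\<lambda>q. g q (X q) (Y q))"
  by (rule metric[unfolded riemannian_metric_def, THEN conjunct2, THEN spec, THEN spec, THEN spec,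
      THEN mp, OF conjI[OF assms(1) conjI[OF assms(2,3)]]])

lemma D_combination:
  assumes U: "open U" "p \<in> U" and X: "smooth_vf M U X" and Y: "smooth_vf M U Y" and f: "smooth_map M U f"
  shows "D p v (\<lambda>q. X q + f q *\<^sub>R Y q) = D p v X + (dir_deriv M f p v *\<^sub>R Y p + f p *\<^sub>R D p v Y)"
proof -
  have "smooth_vf M U (\<lambda>q. f q *\<^sub>R Y q)"
    using smooth_vf_combination[OF M U(1) smooth_vf_zero[OF M U(1)] f Y] by simp
  then have "D p v (\<lambda>q. X q + f q *\<^sub>R Y q) = D p v X + D p v (\<lambda>q. f q *\<^sub>R Y q)"
    using lc U X unfolding levi_civita_def affine_connection_def by blast
  moreover have "D p v (\<lambda>q. f q *\<^sub>R Y q) = dir_deriv M f p v *\<^sub>R Y p + f p *\<^sub>R D p v Y"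
    using lc U Y f unfolding levi_civita_def affine_connection_def by blast
  ultimately show ?thesis by simp
qed

lemma D_torsion_free:
  "open U \<Longrightarrow> p \<in> U \<Longrightarrow> smooth_vf M U Y \<Longrightarrow> smooth_vf M U Z \<Longrightarrow>
    D p (Y p) Z - D p (Z p) Y = lie_bracket M Y Z p"
  using lc unfolding levi_civita_def by blast

lemma D_metric:
  "open U \<Longrightarrow> p \<in> U \<Longrightarrow> smooth_vf M U Y \<Longrightarrow> smooth_vf M U Z \<Longrightarrow>
    dir_deriv M (\<lambda>q. g q (Y q) (Z q)) p v = g p (D p v Y) (Z p) + g p (Y p) (D p v Z)"
  using lc unfolding levi_civita_def by blast

lemma h_orth_xi: "g p (h p v) (\<xi> p) = 0"
  using D_metric[OF open_UNIV UNIV_I xi_smooth xi_smooth, of p v]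
  by (simp add: xi_unit dir_deriv_const g_sym[of p "\<xi> p"])

lemma
  shows nbhd_open: "open (nbhd \<sigma> i)" and frame_smooth: "smooth_vf M (nbhd \<sigma> i) (frame \<sigma> i k)"
    and clifford: "clifford_rep \<gamma>"
  using spin unfolding spin_structure_def by blast+

lemma frame_orthonormal: "p \<in> nbhd \<sigma> i \<Longrightarrow> g p (e i k p) (e i l p) = (if k = l then 1 else 0)"
  using spin unfolding spin_structure_def by blast

lemma frame_expansion: "p \<in> nbhd \<sigma> i \<Longrightarrow> v = (\<Sum>k\<in>UNIV. g p v (e i k p) *\<^sub>R e i k p)"
  using orthonormal_expansion[OF g.bounded_bilinear_axioms, of p "\<lambda>k. e i k p"] frame_orthonormal by blast

lemma parseval: "p \<in> nbhd \<sigma> i \<Longrightarrow> (\<Sum>k\<in>UNIV. g p v (e i k p) * g p w (e i k p)) = g p v w"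
  by (subst (2) frame_expansion[of p i v], assumption) (simp add: g.sum_left g.scaleR_left g_sym[of p w])

text \<open>
  Tensorial identities at a point are derived from identities between local vector fields; this
  provides the fields.
\<close>

lemma smooth_extension:
  assumes "p \<in> nbhd \<sigma> i"
  shows "\<exists>Y. smooth_vf M (nbhd \<sigma> i) Y \<and> Y p = v"
proof -
  have "smooth_vf M (nbhd \<sigma> i) (\<lambda>q. \<Sum>k\<in>UNIV. g p v (e i k p) *\<^sub>R e i k q)"
    by (rule smooth_vf_sum[OF M nbhd_open frame_smooth])
  then show ?thesis using frame_expansion[OF assms, of v, symmetric] by blast
qed

lemma horizontal_part:
  assumes "open U" "smooth_vf M U Y"
  shows "section_Q M g \<xi> U (\<lambda>q. Y q + (- g q (Y q) (\<xi> q)) *\<^sub>R \<xi> q)"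
    and "smooth_map M U (\<lambda>q. - g q (Y q) (\<xi> q))"
proof -
  have "smooth_map M U (\<lambda>q. (-1) *\<^sub>R g q (Y q) (\<xi> q))"
    by (rule smooth_map_bilinear[OF bounded_bilinear_scaleR M assms(1) smooth_map_const
          g_smooth[OF assms xi_smooth]])
  then show f: "smooth_map M U (\<lambda>q. - g q (Y q) (\<xi> q))" by simp
  show "section_Q M g \<xi> U (\<lambda>q. Y q + (- g q (Y q) (\<xi> q)) *\<^sub>R \<xi> q)"
    using smooth_vf_combination[OF M assms f xi_smooth]
    by (simp add: section_Q_def g.diff_left g.scaleR_left xi_unit)
qed

text \<open>
  The flow condition only concerns sections of \<open>Q\<close>.  The bilinear form \<open>g(h v, w) + g(v, h w)\<close> is
  insensitive to \<open>\<xi>\<close>-components, since \<open>h\<close> kills \<open>\<xi>\<close> and has values in \<open>Q\<close>; so the condition for the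
  horizontal parts of extensions of \<open>v\<close> and \<open>w\<close> suffices.
\<close>

lemma h_skew:
  assumes p: "p \<in> nbhd \<sigma> i"
  shows "g p (h p v) w = - g p v (h p w)"
proof -
  let ?U = "nbhd \<sigma> i"
  obtain Y W where Y: "smooth_vf M ?U Y" "Y p = v" and W: "smooth_vf M ?U W" "W p = w"
    using smooth_extension[OF p] by metis
  let ?Y = "\<lambda>q. Y q + (- g q (Y q) (\<xi> q)) *\<^sub>R \<xi> q" and ?W = "\<lambda>q. W q + (- g q (W q) (\<xi> q)) *\<^sub>R \<xi> q"
  have s: "section_Q M g \<xi> ?U ?Y" "section_Q M g \<xi> ?U ?W"
    by (rule horizontal_part[OF nbhd_open Y(1)] horizontal_part[OF nbhd_open W(1)])+
  then have sm: "smooth_vf M ?U ?Y" "smooth_vf M ?U ?W" unfolding section_Q_def by blast+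
  have "lie_deriv_metric M g \<xi> ?Y ?W p = 0"
    using flow s p nbhd_open unfolding riemannian_flow_def by blast
  then have "g p (h p (?Y p)) (?W p) + g p (?Y p) (h p (?W p)) = 0"
    unfolding lie_deriv_metric_def D_metric[OF nbhd_open p sm]
      D_torsion_free[OF nbhd_open p xi_smooth sm(1), symmetric]
      D_torsion_free[OF nbhd_open p xi_smooth sm(2), symmetric]
    by (simp add: g.diff_left g.diff_right)
  then show ?thesis
    by (simp add: Y W h.diff h.scale geodesic g.diff_left g.diff_right g.scaleR_left g.scaleR_right
        h_orth_xi g_sym[of p "\<xi> p" "h p _"])
qed

lemma C_add: "C i p (v + w) = C i p v + C i p w"
  and C_scale: "C i p (c *\<^sub>R v) = c *\<^sub>R C i p v"
  and C_frame: "p \<in> nbhd \<sigma> i \<Longrightarrow> C i p (e i k p) = \<gamma> k"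
  by (simp_all add: clifford_mult_def cliff_def frame_coords_def g.add_left g.scaleR_left
      scaleR_add_left sum.distrib scaleR_sum_right frame_orthonormal if_distrib if_distribR cong: if_cong)

lemma C_linear: "linear (C i p)"
  by (rule linearI) (simp_all add: C_add C_scale)

lemma C_coords: "C i p v = (\<Sum>k\<in>UNIV. g p v (e i k p) *\<^sub>R \<gamma> k)"
  by (simp add: clifford_mult_def cliff_def frame_coords_def)

lemma C_anticommute:
  assumes "p \<in> nbhd \<sigma> i"
  shows "C i p v ** C i p w = - (C i p w ** C i p v) - (2 * g p v w) *\<^sub>R mat 1"
  using cliff_anticommute[OF clifford, of "frame_coords g \<sigma> i p v" "frame_coords g \<sigma> i p w"]
  by (simp add: clifford_mult_def frame_coords_def inner_vec_def parseval[OF assms])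

text \<open>
  The matrix of \<open>\<Omega>\<close>, extended by 0 to \<open>\<xi>\<close>, in the spin frame.
\<close>

definition h_matrix where "h_matrix i p k l = g p (h p (e i k p)) (e i l p)"

lemma h_proj_Q: "h p (proj_Q g \<xi> p v) = h p v"
  by (simp add: proj_Q_def h.diff h.scale geodesic)

lemma Omega_form: "\<Omega> i p = (1/2) *\<^sub>R clifford_form \<gamma> (h_matrix i p)"
  by (simp add: Omega_cliff_def oneill_def h_proj_Q C_coords clifford_form_def h_matrix_def mm.sum_right
      mm.scaleR_right)

lemma Omega_frame_sum: "2 *\<^sub>R \<Omega> i p = (\<Sum>k\<in>UNIV. \<gamma> k ** C i p (h p (e i k p)))"
  by (simp add: Omega_cliff_def oneill_def h_proj_Q)

text \<open>
  The connection matrix of the metric connection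
    \<open>D\<^sub>v Y - \<eta>(v) h(Y) - \<eta>(Y) h(v) + g(h(v), Y) \<xi>\<close>
  on the tangent bundle.  It makes \<open>\<xi>\<close> parallel and restricts on \<open>Q\<close> to the transversal Levi-Civita
  connection, so that it describes the latter in frames that are not adapted to the flow.
\<close>

definition transversal_form where
  "transversal_form i p v k l = g p (D p v (frame \<sigma> i k)
      - g p v (\<xi> p) *\<^sub>R h p (e i k p) - g p (e i k p) (\<xi> p) *\<^sub>R h p v + g p (h p v) (e i k p) *\<^sub>R \<xi> p) (e i l p)"

lemma transversal_form_expand:
  "transversal_form i p v k l = g p (D p v (frame \<sigma> i k)) (e i l p) - g p v (\<xi> p) * h_matrix i p k l
    - (g p (\<xi> p) (e i k p) * g p (h p v) (e i l p) - g p (h p v) (e i k p) * g p (\<xi> p) (e i l p))"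
  by (simp add: transversal_form_def h_matrix_def g.diff_left g.add_left g.scaleR_left g_sym[of p "\<xi> p"])

lemma h_matrix_skew: "p \<in> nbhd \<sigma> i \<Longrightarrow> h_matrix i p k l = - h_matrix i p l k"
  unfolding h_matrix_def using h_skew[of p i "e i k p" "e i l p"] by (simp add: g_sym)

lemma transversal_form_skew:
  assumes "p \<in> nbhd \<sigma> i"
  shows "transversal_form i p v k l = - transversal_form i p v l k"
  using connection_form_skew[OF M lc nbhd_open assms frame_smooth frame_orthonormal g_sym, of v k l]
    h_matrix_skew[OF assms, of k l]
  by (simp add: transversal_form_expand)

text \<open>
  For orthogonal \<open>u\<close> and \<open>w\<close> the two Clifford products \<open>u \<cdot> w\<close> and \<open>- w \<cdot> u\<close> agree.
\<close>

lemma wedge_form: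
  assumes "p \<in> nbhd \<sigma> i" "g p u w = 0"
  shows "clifford_form \<gamma> (\<lambda>k l. g p u (e i k p) * g p w (e i l p) - g p w (e i k p) * g p u (e i l p))
    = 2 *\<^sub>R (C i p u ** C i p w)"
proof -
  have "clifford_form \<gamma> (\<lambda>k l. g p u (e i k p) * g p w (e i l p)) = C i p u ** C i p w" for u w
    using clifford_form_tensor[of \<gamma> "frame_coords g \<sigma> i p u" "frame_coords g \<sigma> i p w"]
    by (simp add: clifford_mult_def frame_coords_def)
  moreover have "C i p w ** C i p u = - (C i p u ** C i p w)"
    using C_anticommute[OF assms(1), of w u] assms(2) by (simp add: g_sym)
  ultimately show ?thesis
    using clifford_form_add[of \<gamma> "\<lambda>k l. g p u (e i k p) * g p w (e i l p)"
        "\<lambda>k l. (-1) * (g p w (e i k p) * g p u (e i l p))"]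
      clifford_form_scale[of \<gamma> "-1" "\<lambda>k l. g p w (e i k p) * g p u (e i l p)"]
    by (simp add: scaleR_2)
qed

lemma spin_deriv_form:
  "spin_deriv M g' D' \<sigma>' i p v \<phi> = dir_deriv M (\<phi> i) p v + (1/4) *\<^sub>R
    (clifford_form (gam \<sigma>') (\<lambda>k l. g' p (D' p v (frame \<sigma>' i k)) (frame \<sigma>' i l p)) *v \<phi> i p)"
  by (simp add: spin_deriv_def clifford_form_def mv.sum_left mv.scaleR_left matrix_vector_mul_assoc)

text \<open>
  The terms that distinguish the adapted connection from \<open>D\<close> are the matrices of \<open>\<eta>(v) h\<close> and
  of \<open>\<eta> \<and> g(h(v), _)\<close>, whose Clifford actions are the two corrections in the definition of the transversal
  derivative.
\<close>

lemma transversal_spin_deriv_form: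
  assumes p: "p \<in> nbhd \<sigma> i"
  shows "transversal_spin_deriv M g D \<xi> \<sigma> i p v \<phi>
    = dir_deriv M (\<phi> i) p v + (1/4) *\<^sub>R (clifford_form \<gamma> (transversal_form i p v) *v \<phi> i p)"
proof -
  let ?w = "\<lambda>k l. g p (D p v (frame \<sigma> i k)) (e i l p)"
  let ?b = "\<lambda>k l. g p (\<xi> p) (e i k p) * g p (h p v) (e i l p) - g p (h p v) (e i k p) * g p (\<xi> p) (e i l p)"
  have b: "clifford_form \<gamma> ?b = 2 *\<^sub>R (C i p (\<xi> p) ** C i p (h p v))"
    by (rule wedge_form[OF p]) (simp add: g_sym[of p "\<xi> p"] h_orth_xi)
  have "transversal_form i p v = (\<lambda>k l. ?w k l + ((- g p v (\<xi> p)) * h_matrix i p k l + (-1) * ?b k l))"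
    by (intro ext) (simp add: transversal_form_expand)
  then have "clifford_form \<gamma> (transversal_form i p v) = clifford_form \<gamma> ?w
      + ((- g p v (\<xi> p)) *\<^sub>R (2 *\<^sub>R \<Omega> i p) + (-1) *\<^sub>R (2 *\<^sub>R (C i p (\<xi> p) ** C i p (h p v))))"
    by (simp only: clifford_form_add clifford_form_scale Omega_form b) simp
  then have w: "clifford_form \<gamma> ?w = clifford_form \<gamma> (transversal_form i p v)
      + (2 * g p v (\<xi> p)) *\<^sub>R \<Omega> i p + 2 *\<^sub>R (C i p (\<xi> p) ** C i p (h p v))"
    by simp
  show ?thesis
    by (simp add: transversal_spin_deriv_def spin_deriv_form w oneill_def h_proj_Q mv.add_left
        mv.scaleR_left matrix_vector_mul_assoc scaleR_add_right)
qed

lemma transversal_form_linear: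
  assumes "p \<in> nbhd \<sigma> i"
  shows "linear (\<lambda>v. transversal_form i p v k l)"
proof -
  interpret De: linear "\<lambda>v. D p v (frame \<sigma> i k)"
    by (rule D_linear[OF nbhd_open frame_smooth assms])
  show ?thesis
    by (rule linearI)
      (simp_all add: transversal_form_expand De.add De.scale h.add h.scale g.add_left g.scaleR_left algebra_simps)
qed

lemma transversal_spin_deriv_linear:
  assumes p: "p \<in> nbhd \<sigma> i" and \<phi>: "smooth_map M (nbhd \<sigma> i) (\<phi> i)"
  shows "linear (\<lambda>v. transversal_spin_deriv M g D \<xi> \<sigma> i p v \<phi>)"
proof -
  interpret d: linear "dir_deriv M (\<phi> i) p" by (rule dir_deriv_linear[OF M \<phi> p])
  have add: "transversal_form i p (v + w) = (\<lambda>k l. transversal_form i p v k l + transversal_form i p w k l)"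
    and sc: "transversal_form i p (c *\<^sub>R v) = (\<lambda>k l. c * transversal_form i p v k l)" for v w c
    using linear_add[OF transversal_form_linear[OF p]] linear_scale[OF transversal_form_linear[OF p]]
    by (auto simp: fun_eq_iff)
  show ?thesis
    by (rule linearI)
      (simp_all add: transversal_spin_deriv_form[OF p] d.add d.scale add sc clifford_form_add
        clifford_form_scale mv.add_left mv.scaleR_left algebra_simps)
qed

section \<open>Sasakian manifolds: the transversal 2-form is parallel\<close>

text \<open>
  The bracket \<open>[\<xi>, W]\<close> is \<open>D\<^sub>\<xi> W - h(W)\<close>, which combines the two cases of the definition.
\<close>

lemma transversal_conn_horizontal:
  assumes U: "open U" "p \<in> U" and W: "smooth_vf M U W"
  shows "transversal_conn M g D \<xi> p v W = proj_Q g \<xi> p (D p v W) - g p v (\<xi> p) *\<^sub>R h p (W p)"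
proof -
  interpret DW: linear "\<lambda>v. D p v W" by (rule D_linear[OF U(1) W U(2)])
  show ?thesis
    unfolding transversal_conn_def D_torsion_free[OF U xi_smooth W, symmetric]
    by (simp add: proj_Q_def DW.diff DW.scale g.diff_left g.scaleR_left h_orth_xi algebra_simps)
qed

text \<open>
  The condition \<open>\<nabla>h = 0\<close> is applied to the horizontal part of \<open>Y\<close>.  Passing from it back to \<open>Y\<close> does not
  change \<open>h(Y)\<close>, but \<open>D\<^sub>v\<close> of the vertical part \<open>\<eta>(Y) \<xi>\<close> contributes \<open>\<eta>(Y) h(v)\<close>.  The terms
  \<open>\<eta>(v) h(h(Y))\<close> on the two sides cancel.
\<close>

lemma D_of_h:
  assumes sas: "sasakian M g D \<xi>" and U: "open U" "p \<in> U" and Y: "smooth_vf M U Y"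
  shows "proj_Q g \<xi> p (D p v (\<lambda>q. h q (Y q))) = h p (D p v Y) - g p (Y p) (\<xi> p) *\<^sub>R h p (h p v)"
proof -
  let ?f = "\<lambda>q. - g q (Y q) (\<xi> q)"
  let ?Z = "\<lambda>q. Y q + ?f q *\<^sub>R \<xi> q"
  note Z = horizontal_part[OF U(1) Y]
  have Zs: "smooth_vf M U ?Z" using Z(1) unfolding section_Q_def by blast
  have hZ: "h q (?Z q) = h q (Y q)" for q
    by (simp add: h.diff h.scale geodesic)
  have "transversal_conn M g D \<xi> p v (\<lambda>q. oneill D \<xi> q (?Z q))
      = oneill D \<xi> p (transversal_conn M g D \<xi> p v ?Z)"
    using sas U Z(1) unfolding sasakian_def by blast
  then have "transversal_conn M g D \<xi> p v (\<lambda>q. h q (Y q)) = h p (transversal_conn M g D \<xi> p v ?Z)"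
    unfolding oneill_def hZ .
  then have "proj_Q g \<xi> p (D p v (\<lambda>q. h q (Y q))) - g p v (\<xi> p) *\<^sub>R h p (h p (Y p))
      = h p (D p v ?Z) - g p v (\<xi> p) *\<^sub>R h p (h p (Y p))"
    unfolding transversal_conn_horizontal[OF U Zs] transversal_conn_horizontal[OF U D_smooth[OF U(1) Y xi_smooth]]
    by (simp only: h.diff h.scale h_proj_Q hZ)
  then show ?thesis
    unfolding D_combination[OF U Y xi_smooth Z(2)]
    by (simp add: h.add h.diff h.scale geodesic)
qed

text \<open>
  This says that \<open>\<Omega>\<close> is parallel for the adapted connection.  The vector \<open>N k\<close> in the proof is the
  adapted derivative of the frame vector \<open>e k\<close>.  The component of \<open>D\<^sub>v(h(e k))\<close> along \<open>\<xi>\<close>, not controlled by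
  \<open>\<nabla>h = 0\<close>, is determined by \<open>g(h(e k), \<xi>) = 0\<close> and is absorbed by the \<open>\<eta>(e l) h(v)\<close> term of \<open>N l\<close>.
\<close>

lemma dir_deriv_h_matrix:
  assumes sas: "sasakian M g D \<xi>" and p: "p \<in> nbhd \<sigma> i"
  shows "dir_deriv M (\<lambda>q. h_matrix i q k l) p v
    = (\<Sum>a\<in>UNIV. transversal_form i p v k a * h_matrix i p a l + transversal_form i p v l a * h_matrix i p k a)"
proof -
  define N where "N k = D p v (frame \<sigma> i k) - g p v (\<xi> p) *\<^sub>R h p (e i k p)
      - g p (e i k p) (\<xi> p) *\<^sub>R h p v + g p (h p v) (e i k p) *\<^sub>R \<xi> p" for k
  have hN: "h p (N k) = (\<Sum>a\<in>UNIV. transversal_form i p v k a *\<^sub>R h p (e i a p))" for k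
    by (subst frame_expansion[OF p, of "N k"]) (simp add: h.sum h.scale transversal_form_def N_def)
  have 1: "(\<Sum>a\<in>UNIV. transversal_form i p v k a * h_matrix i p a l) = g p (h p (N k)) (e i l p)"
    by (simp add: hN g.sum_left g.scaleR_left h_matrix_def)
  have 2: "(\<Sum>a\<in>UNIV. transversal_form i p v l a * h_matrix i p k a) = g p (h p (e i k p)) (N l)"
    by (subst frame_expansion[OF p, of "N l"]) (simp add: transversal_form_def N_def h_matrix_def g.sum_right g.scaleR_right)
  let ?hk = "\<lambda>q. h q (e i k q)"
  note hk = D_smooth[OF nbhd_open frame_smooth xi_smooth, of i k]
  have dec: "D p v ?hk = proj_Q g \<xi> p (D p v ?hk) - g p (h p (e i k p)) (h p v) *\<^sub>R \<xi> p"
  proof -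
    have "g p (D p v ?hk) (\<xi> p) + g p (h p (e i k p)) (h p v) = 0"
      using D_metric[OF nbhd_open p hk xi_smooth, of v] by (simp add: h_orth_xi dir_deriv_const)
    then show ?thesis by (simp add: proj_Q_def add_eq_0_iff)
  qed
  have "dir_deriv M (\<lambda>q. h_matrix i q k l) p v = g p (D p v ?hk) (e i l p) + g p (h p (e i k p)) (D p v (frame \<sigma> i l))"
    unfolding h_matrix_def by (rule D_metric[OF nbhd_open p hk frame_smooth])
  also have "\<dots> = g p (h p (N k)) (e i l p) + g p (h p (e i k p)) (N l)"
    unfolding N_def
    by (subst dec, subst D_of_h[OF sas nbhd_open p frame_smooth])
      (simp add: h.add h.diff h.scale geodesic g.add_left g.diff_left g.scaleR_left g.add_right g.diff_right
        g.scaleR_right h_orth_xi h_skew[OF p, of "h p (e i k p)"] g_sym[of p "\<xi> p"])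
  finally show ?thesis by (simp add: sum.distrib 1 2)
qed

lemma h_matrix_smooth: "smooth_map M (nbhd \<sigma> i) (\<lambda>q. h_matrix i q k l)"
  unfolding h_matrix_def
  by (rule g_smooth[OF nbhd_open D_smooth[OF nbhd_open frame_smooth xi_smooth] frame_smooth])

lemma Omega_smooth: "smooth_map M (nbhd \<sigma> i) (\<Omega> i)"
  and dir_deriv_Omega: "p \<in> nbhd \<sigma> i \<Longrightarrow>
    dir_deriv M (\<Omega> i) p v = (1/2) *\<^sub>R clifford_form \<gamma> (\<lambda>k l. dir_deriv M (\<lambda>q. h_matrix i q k l) p v)"
proof -
  have \<Omega>: "\<Omega> i = (\<lambda>q. (1/2) *\<^sub>R (\<Sum>k\<in>UNIV. \<Sum>l\<in>UNIV. h_matrix i q k l *\<^sub>R (\<gamma> k ** \<gamma> l)))"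
    by (intro ext) (simp add: Omega_form clifford_form_def)
  have s: "smooth_map M (nbhd \<sigma> i) (\<lambda>q. h_matrix i q k l *\<^sub>R (\<gamma> k ** \<gamma> l))" for k l
    by (rule smooth_map_bilinear[OF bounded_bilinear_scaleR M nbhd_open h_matrix_smooth smooth_map_const])
  have s1: "smooth_map M (nbhd \<sigma> i) (\<lambda>q. \<Sum>l\<in>UNIV. h_matrix i q k l *\<^sub>R (\<gamma> k ** \<gamma> l))" for k
    by (rule smooth_map_sum[OF M nbhd_open s])
  have s2: "smooth_map M (nbhd \<sigma> i) (\<lambda>q. \<Sum>k\<in>UNIV. \<Sum>l\<in>UNIV. h_matrix i q k l *\<^sub>R (\<gamma> k ** \<gamma> l))"
    by (rule smooth_map_sum[OF M nbhd_open s1])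
  show "smooth_map M (nbhd \<sigma> i) (\<Omega> i)" unfolding \<Omega>
    by (rule smooth_map_bilinear[OF bounded_bilinear_scaleR M nbhd_open smooth_map_const s2])
  show "dir_deriv M (\<Omega> i) p v = (1/2) *\<^sub>R clifford_form \<gamma> (\<lambda>k l. dir_deriv M (\<lambda>q. h_matrix i q k l) p v)"
    if p: "p \<in> nbhd \<sigma> i"
    unfolding \<Omega> dir_deriv_bilinear[OF bounded_bilinear_scaleR M p smooth_map_const s2]
      dir_deriv_sum[OF M nbhd_open p s1] dir_deriv_sum[OF M nbhd_open p s]
      dir_deriv_bilinear[OF bounded_bilinear_scaleR M p h_matrix_smooth smooth_map_const]
    by (simp add: dir_deriv_const clifford_form_def)
qed

text \<open>
  The derivative of the matrix of \<open>\<Omega>\<close> computed in \<open>dir_deriv_h_matrix\<close> is exactly the one that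
  cancels the commutator of \<open>\<Omega>\<close> with the connection matrix.
\<close>

lemma Omega_parallel:
  assumes sas: "sasakian M g D \<xi>" and p: "p \<in> nbhd \<sigma> i" and \<phi>: "smooth_map M (nbhd \<sigma> i) (\<phi> i)"
  shows "transversal_spin_deriv M g D \<xi> \<sigma> i p v (\<lambda>i q. \<Omega> i q *v \<phi> i q)
    = \<Omega> i p *v transversal_spin_deriv M g D \<xi> \<sigma> i p v \<phi>"
proof -
  let ?dH = "\<lambda>k l. \<Sum>a\<in>UNIV. transversal_form i p v k a * h_matrix i p a l + transversal_form i p v l a * h_matrix i p k a"
  have "clifford_form \<gamma> (transversal_form i p v) ** \<Omega> i p
      = \<Omega> i p ** clifford_form \<gamma> (transversal_form i p v) - 2 *\<^sub>R clifford_form \<gamma> ?dH"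
    using commutator_clifford_forms[OF clifford transversal_form_skew[OF p], where B = "h_matrix i p"]
    by (simp add: Omega_form mm.scaleR_left mm.scaleR_right scaleR_diff_right)
  then show ?thesis
    by (simp add: transversal_spin_deriv_form[OF p]
        dir_deriv_bilinear[OF bounded_bilinear_matrix_vector M p Omega_smooth \<phi>] dir_deriv_Omega[OF p]
        dir_deriv_h_matrix[OF sas p] matrix_vector_mul_assoc mv.diff_left mv.scaleR_left mv.scaleR_right
        mv.add_right scaleR_diff_right)
qed

end

section \<open>The spinorial connection of the D-homothetic deformation\<close>

context spin_flow
begin

abbreviation "\<eta> p v \<equiv> g p v (\<xi> p)"

lemma dhom_metric_alt: "dhom_metric g \<xi> t p v w = t * g p v w + (t\<^sup>2 - t) * (\<eta> p v * \<eta> p w)"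
  by (simp add: dhom_metric_def proj_Q_def g.diff_left g.diff_right g.scaleR_left g.scaleR_right
      xi_unit g_sym[of p "\<xi> p"] algebra_simps power2_eq_square)

lemma dhom_isometry_alt:
  "dhom_isometry g \<xi> t p v = (1 / sqrt t) *\<^sub>R v + ((1 / t - 1 / sqrt t) * \<eta> p v) *\<^sub>R \<xi> p"
  by (simp add: dhom_isometry_def proj_Q_def algebra_simps)

lemma bounded_bilinear_dhom_metric: "bounded_bilinear (dhom_metric g \<xi> t p)"
  unfolding bilinear_conv_bounded_bilinear[symmetric] bilinear_def dhom_metric_alt
  by (auto intro!: linearI simp: g.add_left g.add_right g.scaleR_left g.scaleR_right algebra_simps)

lemma eta_dhom_isometry: "\<eta> p (dhom_isometry g \<xi> t p v) = \<eta> p v / t"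
  by (simp add: dhom_isometry_alt g.add_left g.diff_left g.scaleR_left xi_unit algebra_simps)

lemma h_dhom_isometry: "h p (dhom_isometry g \<xi> t p v) = (1 / sqrt t) *\<^sub>R h p v"
  by (simp add: dhom_isometry_alt h.add h.scale geodesic)

lemma dhom_metric_isometry:
  assumes "t > 0"
  shows "dhom_metric g \<xi> t p v (dhom_isometry g \<xi> t p w) = sqrt t * g p v w + (t - sqrt t) * (\<eta> p v * \<eta> p w)"
proof -
  define s where "s = sqrt t"
  have s: "s > 0" "t = s * s" using assms by (auto simp: s_def)
  show ?thesis
    unfolding dhom_metric_alt eta_dhom_isometry unfolding dhom_isometry_alt s_def[symmetric]
    using s by (simp add: g.add_right g.scaleR_right field_simps power2_eq_square)
qed

lemma dhom_isometry:
  assumes "t > 0"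
  shows "dhom_metric g \<xi> t p (dhom_isometry g \<xi> t p v) (dhom_isometry g \<xi> t p w) = g p v w"
proof -
  define s where "s = sqrt t"
  have s: "s > 0" "t = s * s" using assms by (auto simp: s_def)
  show ?thesis
    unfolding dhom_metric_isometry[OF assms] eta_dhom_isometry
    unfolding dhom_isometry_alt s_def[symmetric]
    using s by (simp add: g.add_left g.scaleR_left g_sym[of p "\<xi> p"] field_simps)
qed

abbreviation "e' t i k \<equiv> (\<lambda>q. dhom_isometry g \<xi> t q (e i k q))"

lemma
  shows dhom_frame_smooth: "smooth_vf M (nbhd \<sigma> i) (e' t i k)"
    and D_dhom_frame: "p \<in> nbhd \<sigma> i \<Longrightarrow> D p v (e' t i k)
      = (1 / sqrt t) *\<^sub>R D p v (frame \<sigma> i k) + (1 / t - 1 / sqrt t) *\<^sub>R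
        ((g p (D p v (frame \<sigma> i k)) (\<xi> p) + g p (e i k p) (h p v)) *\<^sub>R \<xi> p + \<eta> p (e i k p) *\<^sub>R h p v)"
proof -
  let ?U = "nbhd \<sigma> i" and ?c = "1 / t - 1 / sqrt t"
  have comb: "e' t i k
      = (\<lambda>q. (0 + (1 / sqrt t) *\<^sub>R e i k q) + (?c *\<^sub>R \<eta> q (e i k q)) *\<^sub>R \<xi> q)"
    by (simp add: dhom_isometry_alt)
  note z = smooth_vf_zero[OF M nbhd_open]
  have \<eta>: "smooth_map M ?U (\<lambda>q. \<eta> q (e i k q))"
    by (rule g_smooth[OF nbhd_open frame_smooth xi_smooth])
  have f: "smooth_map M ?U (\<lambda>q. ?c *\<^sub>R \<eta> q (e i k q))"
    by (rule smooth_map_bilinear[OF bounded_bilinear_scaleR M nbhd_open smooth_map_const \<eta>])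
  have e: "smooth_vf M ?U (\<lambda>q. 0 + (1 / sqrt t) *\<^sub>R e i k q)"
    by (rule smooth_vf_combination[OF M nbhd_open z smooth_map_const frame_smooth])
  show "smooth_vf M ?U (e' t i k)"
    unfolding comb by (rule smooth_vf_combination[OF M nbhd_open e f xi_smooth])
  assume p: "p \<in> ?U"
  have z': "D p v (\<lambda>q. 0) = 0"
  proof -
    have "D p v (\<lambda>q. 0 + (1::real) *\<^sub>R 0) = D p v (\<lambda>q. 0) + (dir_deriv M (\<lambda>q. 1::real) p v *\<^sub>R 0 + 1 *\<^sub>R D p v (\<lambda>q. 0))"
      by (rule D_combination[OF nbhd_open p z z smooth_map_const])
    then show ?thesis by simp
  qed
  show "D p v (e' t i k)
      = (1 / sqrt t) *\<^sub>R D p v (frame \<sigma> i k) + ?c *\<^sub>R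
        ((g p (D p v (frame \<sigma> i k)) (\<xi> p) + g p (e i k p) (h p v)) *\<^sub>R \<xi> p + \<eta> p (e i k p) *\<^sub>R h p v)"
    unfolding comb D_combination[OF nbhd_open p e xi_smooth f]
      D_combination[OF nbhd_open p z frame_smooth smooth_map_const]
      dir_deriv_bilinear[OF bounded_bilinear_scaleR M p smooth_map_const \<eta>]
      D_metric[OF nbhd_open p frame_smooth xi_smooth]
    by (simp add: z' dir_deriv_const scaleR_add_right)
qed

text \<open>
  The Levi-Civita connection of the undeformed metric, in the deformed metric and its frame.  Only
  mixed terms, which pair \<open>\<eta>\<close> with \<open>h(v)\<close>, are added to its matrix in the original frame, because rescaling \<open>\<xi>\<close>
  and \<open>Q\<close> by constants only affects the part of the connection that exchanges the two.
\<close>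

lemma dhom_metric_D_dhom_frame:
  assumes t: "t > 0" and p: "p \<in> nbhd \<sigma> i"
  shows "dhom_metric g \<xi> t p (D p v (e' t i k)) (e' t i l p) = g p (D p v (frame \<sigma> i k)) (e i l p)
    + (1 - sqrt t) * g p (h p v) (e i k p) * \<eta> p (e i l p) + (1 / sqrt t - 1) * \<eta> p (e i k p) * g p (h p v) (e i l p)"
proof -
  define s where "s = sqrt t"
  have s: "s > 0" "t = s * s" using t by (auto simp: s_def)
  have coeffs: "s * ((1/s) * W + (1 / t - 1 / s) * ((Wx + G) * z + y * K))
      + (t - s) * (((1/s) * Wx + (1 / t - 1 / s) * (Wx + G)) * z)
    = W + (1 - s) * G * z + (1 / s - 1) * y * K" for W Wx G K y z
    using s by (simp add: field_simps)
  show ?thesis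
    unfolding dhom_metric_isometry[OF t] D_dhom_frame[OF p] s_def[symmetric] g.add_left g.scaleR_left
      h_orth_xi xi_unit g_sym[of p "\<xi> p"] g_sym[of p "e i k p" "h p v"]
      real_scaleR_def mult_1_right mult_zero_right add_0_right
    by (rule coeffs)
qed

text \<open>
  The deformed Levi-Civita connection is
    \<open>D\<^sub>X Y + (t - 1) (\<eta>(X) h(Y) + \<eta>(Y) h(X))\<close>,
  and the right-hand side of the lemma is its matrix in the deformed frame.  As for the fundamental
  theorem of Riemannian geometry, the difference \<open>B c k l\<close> of the two matrices is skew in \<open>k, l\<close> because
  both are metric, symmetric in \<open>c, k\<close> because the torsions agree, and therefore zero.  Symmetry
  is checked without introducing the new connection: both \<open>D'\<close> and \<open>D\<close> are torsion-free, and the difference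
  of \<open>D\<close> and the right-hand side is visibly symmetric.
\<close>

lemma dhom_connection_form:
  fixes c :: 'n
  assumes t: "t > 0" and lc': "levi_civita M (dhom_metric g \<xi> t) D'" and p: "p \<in> nbhd \<sigma> i"
  defines "v \<equiv> e' t i c p"
  shows "dhom_metric g \<xi> t p (D' p v (e' t i k)) (e' t i l p)
    = transversal_form i p v k l + t * \<eta> p v * h_matrix i p k l
      + sqrt t * (g p (\<xi> p) (e i k p) * g p (h p v) (e i l p) - g p (h p v) (e i k p) * g p (\<xi> p) (e i l p))"
    (is "_ = ?R v k l")
proof -
  interpret g': bounded_bilinear "dhom_metric g \<xi> t p" by (rule bounded_bilinear_dhom_metric)
  define s where "s = sqrt t"
  have s: "s > 0" "t = s * s" using t by (auto simp: s_def)
  let ?g' = "dhom_metric g \<xi> t p" and ?e = "\<lambda>k. e' t i k p"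
  define B where "B c k l = ?g' (D' p (?e c) (e' t i k)) (?e l) - ?R (?e c) k l" for c k l
  have skew: "B c k l = - B c l k" for c k l
  proof -
    have "?g' (D' p (?e c) (e' t i k)) (?e l) = - ?g' (D' p (?e c) (e' t i l)) (?e k)"
      using dhom_isometry[OF t] frame_orthonormal
      by (intro connection_form_skew[OF M lc' nbhd_open p dhom_frame_smooth])
        (auto simp: dhom_metric_alt g_sym)
    then show ?thesis
      unfolding B_def using transversal_form_skew[OF p, of "?e c" k l] h_matrix_skew[OF p, of k l]
      by (simp add: algebra_simps)
  qed
  have coeffs: "W + (1 - s) * (1 / s * b) * z + (1 / s - 1) * y * (1 / s * a)
      - (W - x / t * d - (y * (1 / s * a) - 1 / s * b * z) + t * (x / t) * d
        + s * (y * (1 / s * a) - 1 / s * b * z)) = (1 - t) / t * (x * d + y * a)"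
    if "s > 0" "t = s * s" for W a b d x y z s t :: real
    using that by (simp add: field_simps)
  have symm: "B c k l = B k c l" for c k l
  proof -
    have "D' p (?e c) (e' t i k) - D' p (?e k) (e' t i c) = lie_bracket M (e' t i c) (e' t i k) p"
      using lc' nbhd_open p dhom_frame_smooth unfolding levi_civita_def by blast
    then have "D' p (?e c) (e' t i k) - D' p (?e k) (e' t i c)
        = D p (?e c) (e' t i k) - D p (?e k) (e' t i c)"
      using D_torsion_free[OF nbhd_open p dhom_frame_smooth dhom_frame_smooth] by simp
    then have "?g' (D' p (?e c) (e' t i k)) (?e l) - ?g' (D' p (?e k) (e' t i c)) (?e l)
        = ?g' (D p (?e c) (e' t i k)) (?e l) - ?g' (D p (?e k) (e' t i c)) (?e l)"
      by (simp flip: g'.diff_left)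
    moreover
    have key: "?g' (D p (?e c) (e' t i k)) (?e l) - ?R (?e c) k l
      = (1 - t) / t * (\<eta> p (e i c p) * h_matrix i p k l + \<eta> p (e i k p) * h_matrix i p c l)" for c k l
      unfolding dhom_metric_D_dhom_frame[OF t p] transversal_form_expand eta_dhom_isometry h_dhom_isometry
        s_def[symmetric] h_matrix_def g.scaleR_left real_scaleR_def g_sym[of p "\<xi> p"]
      by (rule coeffs[OF s])
    have "?g' (D p (?e c) (e' t i k)) (?e l) - ?R (?e c) k l
        = ?g' (D p (?e k) (e' t i c)) (?e l) - ?R (?e k) c l"
      unfolding key by (simp only: add.commute)
    ultimately show ?thesis unfolding B_def by linarith
  qed
  have "B c k l = 0"
    using skew[of c k l] symm[of c l k] skew[of l c k] symm[of l k c] skew[of k l c] symm[of k c l] by simp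
  then show ?thesis unfolding B_def v_def by simp
qed

lemma dhom_spin_deriv:
  fixes c :: 'n
  assumes t: "t > 0" and lc': "levi_civita M (dhom_metric g \<xi> t) D'" and p: "p \<in> nbhd \<sigma> i"
  defines "v \<equiv> e' t i c p"
  shows "spin_deriv M (dhom_metric g \<xi> t) D' (dhom_spin g \<xi> t \<sigma>) i p v \<phi>
    = transversal_spin_deriv M g D \<xi> \<sigma> i p v \<phi> + (t * \<eta> p v / 2) *\<^sub>R (\<Omega> i p *v \<phi> i p)
      + (sqrt t / 2) *\<^sub>R (C i p (\<xi> p) *v (C i p (h p v) *v \<phi> i p))"
proof -
  let ?b = "\<lambda>k l. g p (\<xi> p) (e i k p) * g p (h p v) (e i l p) - g p (h p v) (e i k p) * g p (\<xi> p) (e i l p)"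
  have b: "clifford_form \<gamma> ?b = 2 *\<^sub>R (C i p (\<xi> p) ** C i p (h p v))"
    by (rule wedge_form[OF p]) (simp add: g_sym[of p "\<xi> p"] h_orth_xi)
  have "clifford_form \<gamma> (\<lambda>k l. dhom_metric g \<xi> t p (D' p v (e' t i k)) (e' t i l p))
      = clifford_form \<gamma> (transversal_form i p v) + (t * \<eta> p v) *\<^sub>R clifford_form \<gamma> (h_matrix i p) + sqrt t *\<^sub>R clifford_form \<gamma> ?b"
    unfolding v_def dhom_connection_form[OF t lc' p] clifford_form_add clifford_form_scale ..
  also have "\<dots> = clifford_form \<gamma> (transversal_form i p v) + (2 * t * \<eta> p v) *\<^sub>R \<Omega> i p
      + (2 * sqrt t) *\<^sub>R (C i p (\<xi> p) ** C i p (h p v))"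
    by (simp add: b Omega_form)
  finally show ?thesis
    by (simp add: spin_deriv_form transversal_spin_deriv_form[OF p] dhom_spin_def mv.add_left
        mv.scaleR_left matrix_vector_mul_assoc scaleR_add_right)
qed

text \<open>
  In the sum over the frame, \<open>\<eta>\<close> contributes \<open>1/t\<close> and \<open>h\<close> contributes \<open>1/sqrt t\<close>.  The \<open>\<Omega>\<close>-term gives
  \<open>1/2 \<xi> \<cdot> \<Omega>\<close>.  In the last term \<open>e k\<close> anticommutes with \<open>\<xi>\<close> up to \<open>\<eta>(e k)\<close>, which is traced against
  \<open>h(e k)\<close> to \<open>h(\<xi>) = 0\<close>; what remains is \<open>- \<xi> \<cdot> \<Omega>\<close>.
\<close>

lemma dhom_dirac:
  assumes t: "t > 0" and lc': "levi_civita M (dhom_metric g \<xi> t) D'" and p: "p \<in> nbhd \<sigma> i"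
    and killing: "\<And>v. transversal_spin_deriv M g D \<xi> \<sigma> i p v \<phi> = (\<eta> p v * \<alpha>) *\<^sub>R (C i p (\<xi> p) *v \<phi> i p)"
  shows "dirac M (dhom_metric g \<xi> t) D' (dhom_spin g \<xi> t \<sigma>) \<phi> i p
    = - (\<alpha> / t) *\<^sub>R \<phi> i p - (1/2) *\<^sub>R (C i p (\<xi> p) *v (\<Omega> i p *v \<phi> i p))"
proof -
  let ?w = "\<phi> i p" and ?X = "C i p (\<xi> p)"
  have X: "(\<Sum>k\<in>UNIV. \<eta> p (e i k p) *\<^sub>R \<gamma> k) = ?X"
    by (simp add: C_coords g_sym[of p "\<xi> p"])
  have XX: "?X ** ?X = - mat 1"
  proof -
    have "?X ** ?X + ?X ** ?X = - (2 *\<^sub>R mat 1)"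
      using C_anticommute[OF p, of "\<xi> p" "\<xi> p"]
      unfolding xi_unit mult_1_right eq_diff_eq eq_neg_iff_add_eq_0 by (simp only: add_ac)
    then have "?X ** ?X + ?X ** ?X = 2 *\<^sub>R (- mat 1)" by (simp only: scaleR_minus_right)
    then have "2 *\<^sub>R (?X ** ?X) = 2 *\<^sub>R (- mat 1)" by (simp only: scaleR_2[of "?X ** ?X"])
    then show ?thesis unfolding scaleR_cancel_left by simp
  qed
  have swap: "\<gamma> k ** ?X = - (?X ** \<gamma> k) - (2 * \<eta> p (e i k p)) *\<^sub>R mat 1" for k
    using C_anticommute[OF p, of "e i k p" "\<xi> p"] by (simp add: C_frame[OF p])
  have hX: "(\<Sum>k\<in>UNIV. \<eta> p (e i k p) *\<^sub>R C i p (h p (e i k p))) = 0"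
  proof -
    have "(\<Sum>k\<in>UNIV. \<eta> p (e i k p) *\<^sub>R C i p (h p (e i k p))) = C i p (h p (\<Sum>k\<in>UNIV. g p (\<xi> p) (e i k p) *\<^sub>R e i k p))"
      by (simp add: h.sum h.scale linear_sum[OF C_linear] C_scale g_sym[of p "\<xi> p"])
    also have "\<dots> = 0"
      using frame_expansion[OF p, of "\<xi> p"] by (simp add: geodesic linear_0[OF C_linear])
    finally show ?thesis .
  qed
  have XO: "(\<Sum>k\<in>UNIV. \<gamma> k ** ?X ** C i p (h p (e i k p))) = - 2 *\<^sub>R (?X ** \<Omega> i p)"
  proof -
    have "(\<Sum>k\<in>UNIV. \<gamma> k ** ?X ** C i p (h p (e i k p)))
        = - (?X ** (\<Sum>k\<in>UNIV. \<gamma> k ** C i p (h p (e i k p)))) - 2 *\<^sub>R (\<Sum>k\<in>UNIV. \<eta> p (e i k p) *\<^sub>R C i p (h p (e i k p)))"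
      by (simp add: swap mm.diff_left mm.minus_left mm.scaleR_left sum_subtractf sum_negf mm.sum_right
          scaleR_sum_right matrix_mul_assoc)
    then show ?thesis by (simp add: hX Omega_frame_sum[symmetric] mm.scaleR_right)
  qed
  have "dirac M (dhom_metric g \<xi> t) D' (dhom_spin g \<xi> t \<sigma>) \<phi> i p
      = (\<Sum>k\<in>UNIV. (\<alpha> / t) *\<^sub>R ((\<eta> p (e i k p) *\<^sub>R \<gamma> k) ** ?X *v ?w)
        + (1/2) *\<^sub>R ((\<eta> p (e i k p) *\<^sub>R \<gamma> k) ** \<Omega> i p *v ?w)
        + (1/2) *\<^sub>R (\<gamma> k ** ?X ** C i p (h p (e i k p)) *v ?w))"
    unfolding dirac_def
  proof (intro sum.cong refl)
    fix k
    have "gam (dhom_spin g \<xi> t \<sigma>) = \<gamma>" and "frame (dhom_spin g \<xi> t \<sigma>) i k p = e' t i k p"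
      by (simp_all add: dhom_spin_def)
    then show "gam (dhom_spin g \<xi> t \<sigma>) k *v spin_deriv M (dhom_metric g \<xi> t) D' (dhom_spin g \<xi> t \<sigma>) i p
          (frame (dhom_spin g \<xi> t \<sigma>) i k p) \<phi>
        = (\<alpha> / t) *\<^sub>R ((\<eta> p (e i k p) *\<^sub>R \<gamma> k) ** ?X *v ?w)
        + (1/2) *\<^sub>R ((\<eta> p (e i k p) *\<^sub>R \<gamma> k) ** \<Omega> i p *v ?w)
        + (1/2) *\<^sub>R (\<gamma> k ** ?X ** C i p (h p (e i k p)) *v ?w)"
      using t by (simp add: dhom_spin_deriv[OF t lc' p] killing eta_dhom_isometry h_dhom_isometry C_scale
          mv.add_right mv.scaleR_left mv.scaleR_right mm.scaleR_left matrix_vector_mul_assoc matrix_mul_assoc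
          mult.commute)
  qed
  also have "\<dots> = (\<alpha> / t) *\<^sub>R ((\<Sum>k\<in>UNIV. \<eta> p (e i k p) *\<^sub>R \<gamma> k) ** ?X *v ?w)
        + (1/2) *\<^sub>R ((\<Sum>k\<in>UNIV. \<eta> p (e i k p) *\<^sub>R \<gamma> k) ** \<Omega> i p *v ?w)
        + (1/2) *\<^sub>R ((\<Sum>k\<in>UNIV. \<gamma> k ** ?X ** C i p (h p (e i k p))) *v ?w)"
    by (simp only: sum.distrib mm.sum_left mv.sum_left scaleR_sum_right)
  also have "\<dots> = - (\<alpha> / t) *\<^sub>R ?w - (1/2) *\<^sub>R (?X ** \<Omega> i p *v ?w)"
    unfolding X XX XO
    by (simp add: mv.minus_left mv.scaleR_left algebra_simps)
  finally show ?thesis by (simp add: matrix_vector_mul_assoc)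
qed

section \<open>The components of a transversal Killing spinor\<close>

lemma lift_clifford:
  assumes "p \<in> nbhd \<sigma> i" "p \<in> nbhd \<sigma> j"
  shows "lift \<sigma> i j p ** C j p v = C i p v ** lift \<sigma> i j p"
proof -
  have "lift \<sigma> i j p ** \<gamma> l = C i p (e j l p) ** lift \<sigma> i j p" for l
    using spin assms unfolding spin_structure_def by blast
  then have "lift \<sigma> i j p ** C j p v = C i p (\<Sum>l\<in>UNIV. g p v (e j l p) *\<^sub>R e j l p) ** lift \<sigma> i j p"
    by (simp add: C_coords[of j] mm.sum_right mm.scaleR_right linear_sum[OF C_linear] C_scale mm.sum_left
        mm.scaleR_left)
  then show ?thesis using frame_expansion[OF assms(2), of v] by simp
qed

text \<open>
  The sum that defines \<open>\<Omega>\<close> does not depend on the orthonormal frame, so after conjugation with the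
  lift it may be evaluated in the frame \<open>i\<close> instead of \<open>j\<close>.
\<close>

lemma lift_Omega:
  assumes i: "p \<in> nbhd \<sigma> i" and j: "p \<in> nbhd \<sigma> j"
  shows "lift \<sigma> i j p ** \<Omega> j p = \<Omega> i p ** lift \<sigma> i j p"
proof -
  let ?L = "lift \<sigma> i j p"
  have O: "2 *\<^sub>R \<Omega> j p = (\<Sum>k\<in>UNIV. C j p (e j k p) ** C j p (h p (e j k p)))"
    if "p \<in> nbhd \<sigma> j" for j
    by (simp add: Omega_frame_sum C_frame[OF that])
  have "2 *\<^sub>R (?L ** \<Omega> j p) = (\<Sum>k\<in>UNIV. C i p (e j k p) ** C i p (h p (e j k p))) ** ?L"
    by (simp add: mm.scaleR_right[symmetric] O[OF j] mm.sum_right mm.sum_left)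
       (simp add: matrix_mul_assoc lift_clifford[OF i j], simp add: matrix_mul_assoc[symmetric] lift_clifford[OF i j])
  also have "(\<Sum>k\<in>UNIV. C i p (e j k p) ** C i p (h p (e j k p)))
      = (\<Sum>k\<in>UNIV. \<Sum>l\<in>UNIV. g p (e i l p) (e j k p) *\<^sub>R (\<gamma> l ** C i p (h p (e j k p))))"
    by (simp add: C_coords[of i p "e j _ p"] mm.sum_left mm.scaleR_left g_sym)
  also have "\<dots> = (\<Sum>l\<in>UNIV. \<gamma> l ** C i p (h p (\<Sum>k\<in>UNIV. g p (e i l p) (e j k p) *\<^sub>R e j k p)))"
    by (subst sum.swap) (simp add: h.sum h.scale linear_sum[OF C_linear] C_scale mm.sum_right mm.scaleR_right)
  also have "\<dots> = 2 *\<^sub>R \<Omega> i p"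
    using frame_expansion[OF j] by (simp add: Omega_frame_sum)
  finally show ?thesis by (simp add: mm.scaleR_left)
qed

end

lemma mat_vector_scale: "mat c *v x = c *s (x :: complex^'s::finite)"
  by (simp add: vec_eq_iff matrix_vector_mult_def mat_def if_distrib if_distribR cong: if_cong)

context spin_flow
begin

lemma transversal_spin_deriv_cong:
  assumes p: "p \<in> nbhd \<sigma> i" and eq: "\<And>q. q \<in> nbhd \<sigma> i \<Longrightarrow> \<phi> i q = \<phi>' i q"
  shows "transversal_spin_deriv M g D \<xi> \<sigma> i p v \<phi> = transversal_spin_deriv M g D \<xi> \<sigma> i p v \<phi>'"
  using dir_deriv_cong[OF M nbhd_open p, of "\<phi> i" "\<phi>' i" v] eq
  by (simp add: transversal_spin_deriv_form[OF p] p)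

lemma transversal_spin_deriv_scale:
  assumes p: "p \<in> nbhd \<sigma> i" and \<phi>: "smooth_map M (nbhd \<sigma> i) (\<phi> i)"
  shows "transversal_spin_deriv M g D \<xi> \<sigma> i p v (\<lambda>i q. c *s \<phi> i q)
    = c *s transversal_spin_deriv M g D \<xi> \<sigma> i p v \<phi>"
  using dir_deriv_bilinear[OF bounded_bilinear_matrix_vector M p smooth_map_const[of M _ "mat c"] \<phi>, of v]
  by (simp add: transversal_spin_deriv_form[OF p] dir_deriv_const mat_vector_scale vector_scalar_commute
      vec_eq_iff algebra_simps scaleR_conv_of_real[where 'a = complex])

lemma transversal_spin_deriv_sum:
  assumes p: "p \<in> nbhd \<sigma> i" and \<phi>: "\<And>r. r \<in> A \<Longrightarrow> smooth_map M (nbhd \<sigma> i) (\<phi> r i)"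
  shows "transversal_spin_deriv M g D \<xi> \<sigma> i p v (\<lambda>i q. \<Sum>r\<in>A. \<phi> r i q)
    = (\<Sum>r\<in>A. transversal_spin_deriv M g D \<xi> \<sigma> i p v (\<phi> r))"
  using dir_deriv_sum[OF M nbhd_open p, of A "\<lambda>r. \<phi> r i" v] \<phi>
  by (simp add: transversal_spin_deriv_form[OF p] sum.distrib mv.sum_right scaleR_sum_right)

end

locale killing_components = spin_flow M g D \<xi> \<sigma>
  for M :: "('a::{t2_space,second_countable_topology}, 'n::finite) atlas"
    and g :: "('a, 'n) metric" and D :: "('a, 'n) connection" and \<xi> :: "'a \<Rightarrow> real^'n"
    and \<sigma> :: "('a, 'n, 's::finite, 'i) spin_data" +
  fixes m :: nat and \<alpha> :: real
    and \<psi> :: "('a, 's, 'i) spinor" and \<psi>c :: "nat \<Rightarrow> ('a, 's, 'i) spinor"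
  assumes sas: "sasakian M g D \<xi>" and convention: "sigma_convention g D \<xi> \<sigma> m"
    and killing: "transversal_killing_spinor M g D \<xi> \<sigma> \<alpha> \<psi>"
    and components: "Sigma_components g D \<xi> \<sigma> m \<psi> \<psi>c"
begin

abbreviation \<mu> :: "nat \<Rightarrow> complex" where "\<mu> r \<equiv> \<i> * (2 * of_nat r - of_nat m)"

lemma inj_eigenvalues: "inj_on \<mu> A"
  by (auto simp: inj_on_def)

lemma Omega_component: "r \<le> m \<Longrightarrow> p \<in> nbhd \<sigma> i \<Longrightarrow> \<Omega> i p *v \<psi>c r i p = \<mu> r *s \<psi>c r i p"
  using components unfolding Sigma_components_def Sigma_fibre_def by blast

lemma sum_components: "p \<in> nbhd \<sigma> i \<Longrightarrow> \<psi> i p = (\<Sum>r\<le>m. \<psi>c r i p)"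
  using components unfolding Sigma_components_def by blast

lemma xi_component:
  assumes "r \<le> m" "p \<in> nbhd \<sigma> i"
  shows "C i p (\<xi> p) *v \<psi>c r i p = ((-1) ^ (r + 1) * \<i>) *s \<psi>c r i p"
proof -
  have "\<psi>c r i p \<in> Sigma_fibre g D \<xi> \<sigma> m r i p"
    using components assms unfolding Sigma_components_def by simp
  then show ?thesis
    using convention assms unfolding sigma_convention_def by simp
qed

lemma psi_spinor_field: "spinor_field M \<sigma> \<psi>"
  using killing unfolding transversal_killing_spinor_def by blast

text \<open>
  The projection of \<open>\<psi>\<close> to an eigenbundle of \<open>\<Omega>\<close> is a Lagrange polynomial in \<open>\<Omega>\<close>.
\<close>

lemma component_smooth:
  assumes "r \<le> m"
  shows "smooth_map M (nbhd \<sigma> i) (\<psi>c r i)"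
proof -
  let ?c = "\<lambda>S r. \<Prod>s\<in>S. \<mu> r - \<mu> s"
  \<comment> \<open>The product of the operators \<open>\<Omega> - \<mu> s\<close> over \<open>s \<in> S\<close>, applied to \<open>\<psi>\<close>, is smooth.\<close>
  have filter: "smooth_map M (nbhd \<sigma> i) (\<lambda>q. \<Sum>r\<le>m. ?c S r *s \<psi>c r i q)" if "finite S" for S
    using that
  proof induction
    case empty
    show ?case
    proof (rule smooth_map_cong[OF M nbhd_open])
      show "smooth_map M (nbhd \<sigma> i) (\<psi> i)"
        using psi_spinor_field unfolding spinor_field_def by blast
      show "\<psi> i q = (\<Sum>r\<le>m. ?c {} r *s \<psi>c r i q)" if "q \<in> nbhd \<sigma> i" for q
        using sum_components[OF that] by (simp only: prod.empty vector_smult_lid)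
    qed
  next
    case (insert s S)
    let ?f = "\<lambda>q. \<Sum>r\<le>m. ?c S r *s \<psi>c r i q"
    show ?case
    proof (rule smooth_map_cong[OF M nbhd_open])
      show "smooth_map M (nbhd \<sigma> i) (\<lambda>q. (\<Omega> i q + mat (- \<mu> s)) *v ?f q)"
        by (intro smooth_map_bilinear[OF bounded_bilinear_matrix_vector M nbhd_open]
            smooth_map_add[OF M nbhd_open] Omega_smooth smooth_map_const insert.IH)
      fix q assume q: "q \<in> nbhd \<sigma> i"
      have "(\<Omega> i q + mat (- \<mu> s)) *v (?c S r *s \<psi>c r i q) = ?c (insert s S) r *s \<psi>c r i q"
        if "r \<in> {..m}" for r
      proof -
        have shift: "c *s (a *s x + (- b) *s x) = ((a - b) * c) *s x" for a b c and x :: "complex^'s"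
          by (simp add: vec_eq_iff algebra_simps)
        have "r \<le> m" using that by simp
        from Omega_component[OF this q] show ?thesis
          by (simp only: vector_scalar_commute mv.add_left mat_vector_scale prod.insert[OF insert.hyps] shift)
      qed
      then show "(\<Omega> i q + mat (- \<mu> s)) *v ?f q = (\<Sum>r\<le>m. ?c (insert s S) r *s \<psi>c r i q)"
        by (simp only: mv.sum_right cong: sum.cong)
    qed
  qed
  \<comment> \<open>Taking all other eigenvalues isolates a nonzero multiple of \<open>\<psi>c r\<close>.\<close>
  let ?S = "{..m} - {r}"
  have nz: "?c ?S r \<noteq> 0" by auto
  show ?thesis
  proof (rule smooth_map_cong[OF M nbhd_open])
    show "smooth_map M (nbhd \<sigma> i) (\<lambda>q. mat (1 / ?c ?S r) *v (\<Sum>u\<le>m. ?c ?S u *s \<psi>c u i q))"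
      by (intro smooth_map_bilinear[OF bounded_bilinear_matrix_vector M nbhd_open] smooth_map_const filter) simp
    fix q
    have "(\<Sum>u\<le>m. ?c ?S u *s \<psi>c u i q) = (\<Sum>u\<in>{r}. ?c ?S u *s \<psi>c u i q)"
    proof (rule sum.mono_neutral_right)
      show "\<forall>u\<in>{..m} - {r}. ?c ?S u *s \<psi>c u i q = 0"
      proof
        fix u assume "u \<in> {..m} - {r}"
        then have "?c ?S u = 0" by (intro prod_zero) auto
        then show "?c ?S u *s \<psi>c u i q = 0" by simp
      qed
    qed (use assms in auto)
    then show "mat (1 / ?c ?S r) *v (\<Sum>u\<le>m. ?c ?S u *s \<psi>c u i q) = \<psi>c r i q"
      using nz by (simp only: mat_vector_scale sum.insert sum.empty finite.emptyI empty_iff not_False_eq_True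
          vector_smult_assoc add_0_right nonzero_divide_eq_eq divide_self times_divide_eq_left mult_1_left
          vector_smult_lid)
  qed
qed

text \<open>
  The lifts intertwine the actions of \<open>\<Omega>\<close>, so both sides of the transition rule are the components of
  one vector \<open>\<psi> i p\<close> for one operator.
\<close>

lemma component_spinor_field:
  assumes "r \<le> m"
  shows "spinor_field M \<sigma> (\<psi>c r)"
  unfolding spinor_field_def
proof (intro conjI allI ballI component_smooth[OF assms])
  fix i j p assume "p \<in> nbhd \<sigma> i \<inter> nbhd \<sigma> j"
  then have i: "p \<in> nbhd \<sigma> i" and j: "p \<in> nbhd \<sigma> j" by auto
  let ?L = "lift \<sigma> i j p"
  have "\<psi>c r i p - ?L *v \<psi>c r j p = 0"
  proof (rule eigenvectors_independent[of "{..m}" \<mu> "\<Omega> i p"])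
    fix r assume "r \<in> {..m}"
    then have "\<Omega> i p *v (?L *v \<psi>c r j p) = \<mu> r *s (?L *v \<psi>c r j p)"
      by (simp only: matrix_vector_mul_assoc lift_Omega[OF i j, symmetric])
        (simp add: matrix_vector_mul_assoc[symmetric] Omega_component[OF _ j] vector_scalar_commute)
    then show "\<Omega> i p *v (\<psi>c r i p - ?L *v \<psi>c r j p) = \<mu> r *s (\<psi>c r i p - ?L *v \<psi>c r j p)"
      using \<open>r \<in> {..m}\<close> by (simp only: mv.diff_right Omega_component[OF _ i] vector_ssub_ldistrib atMost_iff)
  next
    have "\<psi> i p = ?L *v \<psi> j p"
      using psi_spinor_field i j unfolding spinor_field_def by blast
    then show "(\<Sum>r\<le>m. \<psi>c r i p - ?L *v \<psi>c r j p) = 0"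
      by (simp add: sum_components[OF i] sum_components[OF j] sum_subtractf mv.sum_right)
  qed (use assms inj_eigenvalues in auto)
  then show "\<psi>c r i p = ?L *v \<psi>c r j p" by simp
qed

lemma killing_all_directions:
  assumes p: "p \<in> nbhd \<sigma> i"
  shows "transversal_spin_deriv M g D \<xi> \<sigma> i p v \<psi> = (\<eta> p v * \<alpha>) *\<^sub>R (C i p (\<xi> p) *v \<psi> i p)"
proof -
  interpret T: linear "\<lambda>v. transversal_spin_deriv M g D \<xi> \<sigma> i p v \<psi>"
    using transversal_spin_deriv_linear[OF p] psi_spinor_field unfolding spinor_field_def by blast
  have "g p (proj_Q g \<xi> p v) (\<xi> p) = 0"
    by (simp add: proj_Q_def g.diff_left g.scaleR_left xi_unit)
  then have "transversal_spin_deriv M g D \<xi> \<sigma> i p (proj_Q g \<xi> p v) \<psi> = 0"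
    and "transversal_spin_deriv M g D \<xi> \<sigma> i p (\<xi> p) \<psi> = \<alpha> *\<^sub>R (C i p (\<xi> p) *v \<psi> i p)"
    using killing p unfolding transversal_killing_spinor_def by blast+
  then show ?thesis
    by (simp add: proj_Q_def T.diff T.scale)
qed

text \<open>
  Applying \<open>\<nabla>\<^sub>v\<close>, which commutes with \<open>\<Omega>\<close>, and \<open>\<xi>\<cdot>\<close> to \<open>\<psi>c r\<close> stays in the eigenspace for \<open>\<mu> r\<close>.  The
  equation for \<open>\<psi>\<close> is the sum of the equations for the components, and eigenvectors are independent.
\<close>

lemma component_killing:
  assumes r: "r \<le> m" and p: "p \<in> nbhd \<sigma> i"
  shows "transversal_spin_deriv M g D \<xi> \<sigma> i p v (\<psi>c r) = (\<eta> p v * \<alpha>) *\<^sub>R (C i p (\<xi> p) *v \<psi>c r i p)"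
proof -
  let ?T = "transversal_spin_deriv M g D \<xi> \<sigma> i p v"
  have "?T (\<psi>c r) - (\<eta> p v * \<alpha>) *\<^sub>R (C i p (\<xi> p) *v \<psi>c r i p) = 0"
  proof (rule eigenvectors_independent[of "{..m}" \<mu> "\<Omega> i p"])
    fix r assume "r \<in> {..m}"
    then have r: "r \<le> m" by simp
    have "\<Omega> i p *v ?T (\<psi>c r) = ?T (\<lambda>i q. \<Omega> i q *v \<psi>c r i q)"
      by (rule Omega_parallel[where \<phi> = "\<psi>c r", OF sas p component_smooth[OF r], symmetric])
    also have "\<dots> = ?T (\<lambda>i q. \<mu> r *s \<psi>c r i q)"
      by (rule transversal_spin_deriv_cong[OF p Omega_component[OF r]])
    also have "\<dots> = \<mu> r *s ?T (\<psi>c r)"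
      by (rule transversal_spin_deriv_scale[where \<phi> = "\<psi>c r", OF p component_smooth[OF r]])
    finally show "\<Omega> i p *v (?T (\<psi>c r) - (\<eta> p v * \<alpha>) *\<^sub>R (C i p (\<xi> p) *v \<psi>c r i p))
        = \<mu> r *s (?T (\<psi>c r) - (\<eta> p v * \<alpha>) *\<^sub>R (C i p (\<xi> p) *v \<psi>c r i p))"
      by (simp only: xi_component[OF r p] mv.diff_right mv.scaleR_right vector_scalar_commute
          Omega_component[OF r p])
        (simp add: vec_eq_iff algebra_simps scaleR_conv_of_real[where 'a = complex])
  next
    have "(\<Sum>r\<le>m. ?T (\<psi>c r)) = ?T (\<lambda>i q. \<Sum>r\<le>m. \<psi>c r i q)"
      by (rule transversal_spin_deriv_sum[symmetric, OF p]) (simp add: component_smooth)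
    also have "\<dots> = ?T \<psi>"
      by (rule transversal_spin_deriv_cong[OF p sum_components[symmetric]])
    finally show "(\<Sum>r\<le>m. ?T (\<psi>c r) - (\<eta> p v * \<alpha>) *\<^sub>R (C i p (\<xi> p) *v \<psi>c r i p)) = 0"
      by (simp add: killing_all_directions[OF p] sum_components[OF p] sum_subtractf mv.sum_right
          scaleR_sum_right)
  qed (use r inj_eigenvalues in auto)
  then show ?thesis by simp
qed

lemma dhom_dirac_component:
  assumes r: "r \<le> m" and t: "t > 0" and lc': "levi_civita M (dhom_metric g \<xi> t) D'"
    and p: "p \<in> nbhd \<sigma> i"
  shows "dirac M (dhom_metric g \<xi> t) D' (dhom_spin g \<xi> t \<sigma>) (\<psi>c r) i p
    = ((-1) ^ (r + 1) * (2 * real r - real m) / 2 - \<alpha> / t) *\<^sub>R \<psi>c r i p"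
  unfolding dhom_dirac[OF t lc' p component_killing[OF r p]] Omega_component[OF r p]
    vector_scalar_commute xi_component[OF r p]
  by (simp add: vec_eq_iff scaleR_conv_of_real[where 'a = complex] algebra_simps)

lemma harmonic_component:
  assumes r: "r \<le> m" and t: "t > 0" and lc': "levi_civita M (dhom_metric g \<xi> t) D'"
    and eq: "\<alpha> / t = (-1) ^ (r + 1) * (2 * real r - real m) / 2"
  shows "harmonic_spinor M (dhom_metric g \<xi> t) D' (dhom_spin g \<xi> t \<sigma>) (dhom_spinor t (\<psi>c r))"
proof -
  have "nbhd (dhom_spin g \<xi> t \<sigma>) = nbhd \<sigma>" and "lift (dhom_spin g \<xi> t \<sigma>) = lift \<sigma>"
    by (simp_all add: dhom_spin_def)
  then have "spinor_field M (dhom_spin g \<xi> t \<sigma>) (\<psi>c r)"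
    using component_spinor_field[OF r] unfolding spinor_field_def by simp
  moreover have "dirac M (dhom_metric g \<xi> t) D' (dhom_spin g \<xi> t \<sigma>) (\<psi>c r) i p = 0"
    if "p \<in> nbhd \<sigma> i" for i p
    unfolding dhom_dirac_component[OF r t lc' that] eq by simp
  ultimately show ?thesis
    unfolding harmonic_spinor_def dhom_spinor_def \<open>nbhd _ = _\<close> by blast
qed

end

theorem proposition4p2:
  fixes M :: "('a::{t2_space,second_countable_topology}, 'n::finite) atlas"
    and g :: "('a, 'n) metric" and D :: "('a, 'n) connection" and \<xi> :: "'a \<Rightarrow> real^'n"
    and \<sigma> :: "('a, 'n, 's::finite, 'i) spin_data"
    and Dbar :: "real \<Rightarrow> ('a, 'n) connection"
    and m :: nat and \<alpha> :: real
    and \<psi> :: "('a, 's, 'i) spinor" and \<psi>c :: "nat \<Rightarrow> ('a, 's, 'i) spinor"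
  assumes "m \<ge> 1" and "CARD('n) = 2 * m + 1" and "CARD('s) = 2 ^ m"
    and "compact (UNIV :: 'a set)"
    and "sasakian M g D \<xi>"
    and "spin_structure M g \<sigma>"
    and "sigma_convention g D \<xi> \<sigma> m"
    and "\<And>t. t > 0 \<Longrightarrow> levi_civita M (dhom_metric g \<xi> t) (Dbar t)"
    and "\<alpha> \<noteq> 0"
    and "transversal_killing_spinor M g D \<xi> \<sigma> \<alpha> \<psi>" and "nonzero_spinor \<sigma> \<psi>"
    and "\<And>i p. p \<in> nbhd \<sigma> i \<Longrightarrow> norm (\<psi> i p) = 1"
    and "complex_of_real (lambda1_dirac_sq M g D \<sigma>) =
           of_real (\<alpha>\<^sup>2) + of_real ((real m)\<^sup>2 / 4) +
           of_real \<alpha> *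
             (LINT p|riemannian_volume M g.
                spinor_hprod \<sigma>
                  (\<lambda>i p. clifford_mult g \<sigma> i p (\<xi> p) *v (Omega_cliff g D \<xi> \<sigma> i p *v \<psi> i p)) \<psi> p)
             / of_real (measure (riemannian_volume M g) UNIV)"
    and "Sigma_components g D \<xi> \<sigma> m \<psi> \<psi>c"
  shows "(nonzero_spinor \<sigma> (\<psi>c 0) \<and> \<alpha> > 0 \<longrightarrow>
            (let t = 2 * \<alpha> / real m in
             harmonic_spinor M (dhom_metric g \<xi> t) (Dbar t) (dhom_spin g \<xi> t \<sigma>)
               (dhom_spinor t (\<psi>c 0)))) \<and>
         (nonzero_spinor \<sigma> (\<psi>c m) \<and> (-1) ^ (m + 1) * \<alpha> > 0 \<longrightarrow>
            (let t = (-1) ^ (m + 1) * (2 * \<alpha> / real m) in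
             harmonic_spinor M (dhom_metric g \<xi> t) (Dbar t) (dhom_spin g \<xi> t \<sigma>)
               (dhom_spinor t (\<psi>c m))))"
proof -
  interpret killing_components M g D \<xi> \<sigma> m \<alpha> \<psi> \<psi>c
    by unfold_locales (use assms(5,6,7,10,14) in \<open>auto simp: sasakian_def\<close>)
  have m: "real m > 0" using assms(1) by simp
  show ?thesis
  proof (intro conjI impI; unfold Let_def)
    let ?t = "2 * \<alpha> / real m"
    assume "nonzero_spinor \<sigma> (\<psi>c 0) \<and> \<alpha> > 0"
    then have "\<alpha> > 0" and t: "?t > 0" using m by auto
    then show "harmonic_spinor M (dhom_metric g \<xi> ?t) (Dbar ?t) (dhom_spin g \<xi> ?t \<sigma>)
        (dhom_spinor ?t (\<psi>c 0))"
      using m by (intro harmonic_component[OF _ t assms(8)[OF t]]) simp_all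
  next
    let ?\<epsilon> = "(-1) ^ (m + 1) :: real"
    let ?t = "?\<epsilon> * (2 * \<alpha> / real m)"
    have \<epsilon>: "?\<epsilon> * ?\<epsilon> = 1" by (simp flip: power_mult_distrib)
    assume "nonzero_spinor \<sigma> (\<psi>c m) \<and> ?\<epsilon> * \<alpha> > 0"
    then have pos: "?\<epsilon> * \<alpha> > 0" by blast
    have "2 * (?\<epsilon> * \<alpha>) / real m > 0"
      by (rule divide_pos_pos[OF mult_pos_pos[OF zero_less_numeral pos] m])
    then have t: "?t > 0" by (simp add: mult_ac)
    have solve: "a / u = x" if "a = x * u" "u > 0" for a u x :: real
      using that by simp
    have "\<alpha> = ?\<epsilon> * (2 * real m - real m) / 2 * ?t"
      using m \<epsilon> by (simp add: field_simps)
    then have "\<alpha> / ?t = ?\<epsilon> * (2 * real m - real m) / 2"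
      using t by (rule solve)
    then show "harmonic_spinor M (dhom_metric g \<xi> ?t) (Dbar ?t) (dhom_spin g \<xi> ?t \<sigma>)
        (dhom_spinor ?t (\<psi>c m))"
      by (intro harmonic_component[OF _ t assms(8)[OF t]]) simp_all
  qed
qed

end
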